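(* Let $\alpha,\beta\ge-\frac12$, $\mu=\max(\alpha,\beta)$, $\tau=\min(\alpha,\beta)$. Assume that $f$ has $p$ continuous derivatives on $I=[-1,1]$ and that $f^{(p)}\in \mathrm{Lip}(\gamma)$ with $0<\gamma<1$, that $\|f\|_\omega$ and $\|f\|_\infty$ are bounded away from zero, and that $p+\gamma\ge\max(\mu+\frac12,\frac12-\tau)$. Consider observations $Y_i=f(X_i)+\varepsilon_i$, $1\le i\le n$, where $X_1,\dots,X_n$ are i.i.d. with the Beta $B(\alpha+1,\beta+1)$ distribution on $I$ and the $\varepsilon_i$ are i.i.d. centered real random variables with variance $\sigma^2$; let $\pmb\eta_n=\max_{1\le i\le n}|\varepsilon_i|$ and let $\widehat f_{n,N}$ be the least squares estimator defined in the context. Then for any $0<\delta<1$ there is a constant $C>0$ independent of $n,N$ such that, for all sufficiently large $n,N$ with $n>N$ and $0.63\,n>m_{\alpha,\beta}^2(N+1)^{2\mu+2}\log(N+1)$, with probability at least $(1-\delta)^2$, $$\|f-\widehat f_{n,N}\|_\omega\le C\left(\frac{\log N}{N^{p+\gamma}}+\sqrt{2\kappa_2(A_N)}\;\frac{\frac{\log N}{N^{p+\gamma-\mu-\frac12}}+\pmb\eta_n}{\frac{1}{\sqrt{\gamma_{\alpha,\beta}}}-2\Big(\frac1n\log\big(\frac2\delta\big)\Big)^{1/4}\frac{\|f\|_\infty}{\|f\|_\omega}}\right).$$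
   Context: $I=[-1,1]$, $\omega_{\alpha,\beta}(x)=(1-x)^\alpha(1+x)^\beta$, $\|f\|_\omega^2=\int_I|f|^2\omega_{\alpha,\beta}\,dx$, $\|\cdot\|_\infty$ is the sup norm on $I$, and $\mathrm{Lip}(\gamma)$ is the class of functions on $I$ that are Hölder continuous with exponent $\gamma$. The Jacobi polynomials are $P_k^{(\alpha,\beta)}(x)=\frac{(-1)^k}{2^k k!}\frac{1}{\omega_{\alpha,\beta}(x)}\frac{d^k}{dx^k}\big(\omega_{\alpha,\beta}(x)(1-x^2)^k\big)$, and the normalized ones are $\widetilde P^{(\alpha,\beta)}_k=P^{(\alpha,\beta)}_k/\sqrt{h_k^{\alpha,\beta}}$ with $h_k^{\alpha,\beta}=\frac{2^{\alpha+\beta+1}\Gamma(k+\alpha+1)\Gamma(k+\beta+1)}{k!(2k+\alpha+\beta+1)\Gamma(k+\alpha+\beta+1)}$, so that $\|\widetilde P^{(\alpha,\beta)}_k\|_\omega=1$. The Beta $B(\alpha+1,\beta+1)$ distribution on $I$ has density $\omega_{\alpha,\beta}(x)/\gamma_{\alpha,\beta}$, with $\gamma_{\alpha,\beta}=2^{\alpha+\beta+1}B(\alpha+1,\beta+1)$, where $B(\cdot,\cdot)$ is the Beta function (the constant $\gamma_{\alpha,\beta}$ is unrelated to the exponent $\gamma$). Constants: $c_{\alpha,\beta}=\frac{\alpha+\beta+1}{2}$, $\ \eta_{\alpha,\beta}=\frac{\exp\big(\frac{2\max(\mu,0)}{12}+\frac{\max(\mu^2+\alpha\beta,0)}{8}\big)}{2^{(\alpha+\beta)/2}\Gamma(\mu+1)}$,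 $\ m_{\alpha,\beta}^2=\frac{1+\frac12\sqrt{c_{\alpha,\beta}/2}}{\mu+3/2}\,\eta_{\alpha,\beta}^2$. Random matrices: $B_N=\big[\frac{1}{\sqrt n}\widetilde P^{(\alpha,\beta)}_{k-1}(X_j)\big]_{1\le j\le n,\,1\le k\le N+1}$ and $A_N=B_N'B_N$ ($'$ denotes transpose). $\kappa_2(A_N)$ is the $2$-norm condition number, i.e. $\lambda_{\max}(A_N)/\lambda_{\min}(A_N)$ ($+\infty$ if $A_N$ is singular). Estimator: $\widehat f_{n,N}(x)=\sum_{k=1}^{N+1}\widehat c_k\,\widetilde P^{(\alpha,\beta)}_{k-1}(x)$, where $\widehat{\pmb C}=(\widehat c_1,\dots,\widehat c_{N+1})'$ is the least squares solution of $B_N\widehat{\pmb C}=\frac{1}{\sqrt n}(Y_1,\dots,Y_n)'$, that is $\widehat{\pmb C}=(B_N'B_N)^{-1}B_N'\,\frac{1}{\sqrt n}(Y_1,\dots,Y_n)'$ when $A_N$ is invertible. *)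

theory Defs
  imports "HOL-Probability.Probability" "Jordan_Normal_Form.Spectral_Radius"
begin

abbreviation I :: "real set" where "I \<equiv> {-1..1}"

definition jweight :: "real \<Rightarrow> real \<Rightarrow> real \<Rightarrow> real" where
  "jweight \<alpha> \<beta> x = (1 - x) powr \<alpha> * (1 + x) powr \<beta>"

definition wnorm :: "real \<Rightarrow> real \<Rightarrow> (real \<Rightarrow> real) \<Rightarrow> real" where
  "wnorm \<alpha> \<beta> f = sqrt (LINT x:I|lborel. \<bar>f x\<bar>\<^sup>2 * jweight \<alpha> \<beta> x)"

definition supnorm :: "(real \<Rightarrow> real) \<Rightarrow> real" where
  "supnorm f = (SUP x\<in>I. \<bar>f x\<bar>)"

definition Lip :: "real \<Rightarrow> (real \<Rightarrow> real) set" where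
  "Lip \<gamma> = {g. \<exists>L. \<forall>x\<in>I. \<forall>y\<in>I. \<bar>g x - g y\<bar> \<le> L * \<bar>x - y\<bar> powr \<gamma>}"

text \<open>\<open>D k\<close> is the \<open>k\<close>-th derivative of \<open>f\<close> on \<open>I\<close> (one-sided at the end points)
  for \<open>k \<le> p\<close>; the values of \<open>f\<close> outside \<open>I\<close> are irrelevant.\<close>
definition cont_derivs :: "nat \<Rightarrow> (real \<Rightarrow> real) \<Rightarrow> (nat \<Rightarrow> real \<Rightarrow> real) \<Rightarrow> bool" where
  "cont_derivs p f D \<longleftrightarrow>
     (\<forall>x\<in>I. D 0 x = f x) \<and>
     (\<forall>k<p. \<forall>x\<in>I. (D k has_real_derivative D (Suc k) x) (at x within I)) \<and>
     (\<forall>k\<le>p. continuous_on I (D k))"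

definition rodrigues :: "real \<Rightarrow> real \<Rightarrow> nat \<Rightarrow> real \<Rightarrow> real" where
  "rodrigues \<alpha> \<beta> k x =
     (-1) ^ k / (2 ^ k * fact k) * (1 / jweight \<alpha> \<beta> x) *
     (deriv ^^ k) (\<lambda>y. jweight \<alpha> \<beta> y * (1 - y\<^sup>2) ^ k) x"

text \<open>Rodrigues' formula makes sense only on the open interval, where it agrees with a unique
  polynomial; see \<open>poly_jacobi\<close> below.\<close>
definition jacobi :: "real \<Rightarrow> real \<Rightarrow> nat \<Rightarrow> real poly" where
  "jacobi \<alpha> \<beta> k = (THE q. \<forall>x\<in>{-1<..<1}. poly q x = rodrigues \<alpha> \<beta> k x)"

lemma deriv_funpow_jweight:
  assumes g: "\<And>x. x \<in> {-1<..<1} \<Longrightarrow> g x = jweight a b x"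
  shows "\<exists>q. \<forall>x\<in>{-1<..<1}.
    (deriv ^^ j) g x = (1 - x) powr (a - real j) * (1 + x) powr (b - real j) * poly q x"
proof (induction j)
  case 0
  show ?case by (rule exI[of _ 1]) (simp add: g jweight_def)
next
  case (Suc j)
  then obtain q where q: "\<And>x. x \<in> {-1<..<1} \<Longrightarrow>
    (deriv ^^ j) g x = (1 - x) powr (a - real j) * (1 + x) powr (b - real j) * poly q x"
    by blast
  define r where "r = Polynomial.smult (real j - a) ([:1, 1:] * q) + Polynomial.smult (b - real j) ([:1, -1:] * q)
    + [:1, -1:] * [:1, 1:] * pderiv q"
  have "(deriv ^^ Suc j) g x
      = (1 - x) powr (a - real (Suc j)) * (1 + x) powr (b - real (Suc j)) * poly r x"
    if x: "x \<in> {-1<..<1}" for x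
  proof -
    have pos: "1 - x > 0" "1 + x > 0" using x by auto
    define A where "A = (1 - x) powr (a - real (Suc j))"
    define B where "B = (1 + x) powr (b - real (Suc j))"
    have A: "(1 - x) powr (a - real j) = A * (1 - x)"
      using pos powr_add[of "1 - x" "a - real (Suc j)" 1] by (simp add: A_def)
    have B: "(1 + x) powr (b - real j) = B * (1 + x)"
      using pos powr_add[of "1 + x" "b - real (Suc j)" 1] by (simp add: B_def)
    have A': "(1 - x) powr (a - real j - 1) = A" "(1 + x) powr (b - real j - 1) = B"
      by (simp_all add: A_def B_def algebra_simps)
    have "((\<lambda>x. (1 - x) powr (a - real j) * (1 + x) powr (b - real j) * poly q x)
        has_field_derivative A * B * poly r x) (at x)"
      using pos
      by (auto intro!: derivative_eq_intros simp: A' A B r_def powr_diff[symmetric])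
         (simp add: algebra_simps)
    then have "((deriv ^^ j) g has_field_derivative A * B * poly r x) (at x)"
      by (rule has_field_derivative_transform_within_open[of _ _ _ "{-1<..<1}"])
         (use x q in auto)
    then show ?thesis by (simp add: DERIV_imp_deriv A_def B_def)
  qed
  then show ?case by blast
qed

lemma poly_jacobi:
  assumes x: "x \<in> {-1<..<1}"
  shows "poly (jacobi \<alpha> \<beta> k) x = rodrigues \<alpha> \<beta> k x"
proof -
  let ?g = "\<lambda>y. jweight \<alpha> \<beta> y * (1 - y\<^sup>2) ^ k"
  have "?g y = jweight (\<alpha> + real k) (\<beta> + real k) y" if "y \<in> {-1<..<1}" for y
  proof -
    have "1 - y\<^sup>2 = (1 - y) * (1 + y)" by (simp add: power2_eq_square algebra_simps)
    with that show ?thesis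
      by (simp add: jweight_def powr_add powr_realpow power_mult_distrib)
  qed
  from deriv_funpow_jweight[OF this, of k] obtain q where
    q: "\<And>y. y \<in> {-1<..<1} \<Longrightarrow> (deriv ^^ k) ?g y = jweight \<alpha> \<beta> y * poly q y"
    by (auto simp: jweight_def)
  let ?q = "Polynomial.smult ((-1) ^ k / (2 ^ k * fact k)) q"
  have ex: "\<forall>y\<in>{-1<..<1}. poly ?q y = rodrigues \<alpha> \<beta> k y"
  proof
    fix y :: real assume y: "y \<in> {-1<..<1}"
    then have "jweight \<alpha> \<beta> y \<noteq> 0" by (auto simp: jweight_def)
    then show "poly ?q y = rodrigues \<alpha> \<beta> k y"
      by (simp add: rodrigues_def q[OF y])
  qed
  have "\<exists>!r. \<forall>y\<in>{-1<..<1}. poly r y = rodrigues \<alpha> \<beta> k y"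
  proof (rule ex1I[of _ ?q], rule ex)
    fix r assume r: "\<forall>y\<in>{-1<..<1}. poly r y = rodrigues \<alpha> \<beta> k y"
    have "infinite {-1<..<(1::real)}" by simp
    moreover have "{-1<..<1} \<subseteq> {y. poly (r - ?q) y = 0}" using r ex by auto
    ultimately have "infinite {y. poly (r - ?q) y = 0}" using finite_subset by blast
    then show "r = ?q" using poly_roots_finite[of "r - ?q"] by auto
  qed
  from theI'[OF this] x show ?thesis unfolding jacobi_def by blast
qed

text \<open>For \<open>k = 0\<close> the factor \<open>(\<alpha> + \<beta> + 1) \<Gamma>(\<alpha> + \<beta> + 1)\<close> of the usual formula is written as
  \<open>\<Gamma>(\<alpha> + \<beta> + 2)\<close>. This only matters for \<open>\<alpha> + \<beta> = -1\<close>, where the usual formula has to be read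
  as a limit (\<open>0 * Gamma 0\<close> is \<open>0\<close> here); see \<open>jacobi_h_eq\<close> for all other cases.\<close>
definition jacobi_h :: "real \<Rightarrow> real \<Rightarrow> nat \<Rightarrow> real" where
  "jacobi_h \<alpha> \<beta> k =
     (if k = 0 then
        2 powr (\<alpha> + \<beta> + 1) * Gamma (\<alpha> + 1) * Gamma (\<beta> + 1) / Gamma (\<alpha> + \<beta> + 2)
      else
        2 powr (\<alpha> + \<beta> + 1) * Gamma (real k + \<alpha> + 1) * Gamma (real k + \<beta> + 1) /
        (fact k * (2 * real k + \<alpha> + \<beta> + 1) * Gamma (real k + \<alpha> + \<beta> + 1)))"

lemma jacobi_h_eq:
  assumes "\<alpha> + \<beta> + 1 > 0 \<or> k > 0"
  shows "jacobi_h \<alpha> \<beta> k =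
    2 powr (\<alpha> + \<beta> + 1) * Gamma (real k + \<alpha> + 1) * Gamma (real k + \<beta> + 1) /
    (fact k * (2 * real k + \<alpha> + \<beta> + 1) * Gamma (real k + \<alpha> + \<beta> + 1))"
proof (cases "k = 0")
  case True
  with assms have pos: "\<alpha> + \<beta> + 1 > 0" by simp
  then have "\<alpha> + \<beta> + 1 \<notin> \<int>\<^sub>\<le>\<^sub>0" by (auto elim!: nonpos_Ints_cases)
  then have "Gamma (\<alpha> + \<beta> + 1 + 1) = (\<alpha> + \<beta> + 1) * Gamma (\<alpha> + \<beta> + 1)"
    by (rule Gamma_plus1)
  then have "Gamma (\<alpha> + \<beta> + 2) = (\<alpha> + \<beta> + 1) * Gamma (\<alpha> + \<beta> + 1)"
    by (simp add: add.assoc)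
  with True show ?thesis by (simp add: jacobi_h_def)
qed (simp add: jacobi_h_def)

definition njacobi :: "real \<Rightarrow> real \<Rightarrow> nat \<Rightarrow> real \<Rightarrow> real" where
  "njacobi \<alpha> \<beta> k x = poly (jacobi \<alpha> \<beta> k) x / sqrt (jacobi_h \<alpha> \<beta> k)"

definition beta_const :: "real \<Rightarrow> real \<Rightarrow> real" where
  "beta_const \<alpha> \<beta> = 2 powr (\<alpha> + \<beta> + 1) * Beta (\<alpha> + 1) (\<beta> + 1)"

definition c_const :: "real \<Rightarrow> real \<Rightarrow> real" where
  "c_const \<alpha> \<beta> = (\<alpha> + \<beta> + 1) / 2"

definition eta_const :: "real \<Rightarrow> real \<Rightarrow> real" where
  "eta_const \<alpha> \<beta> = (let \<mu> = max \<alpha> \<beta> in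
     exp (2 * max \<mu> 0 / 12 + max (\<mu>\<^sup>2 + \<alpha> * \<beta>) 0 / 8) /
     (2 powr ((\<alpha> + \<beta>) / 2) * Gamma (\<mu> + 1)))"

definition m2_const :: "real \<Rightarrow> real \<Rightarrow> real" where
  "m2_const \<alpha> \<beta> = (let \<mu> = max \<alpha> \<beta> in
     (1 + 1 / 2 * sqrt (c_const \<alpha> \<beta> / 2)) / (\<mu> + 3 / 2) * (eta_const \<alpha> \<beta>)\<^sup>2)"

text \<open>Observations \<open>X\<close> and \<open>Y\<close> are indexed by \<open>1, \<dots>, n\<close>, whereas rows and columns of
  matrices are numbered from \<open>0\<close>.\<close>

definition B_mat :: "real \<Rightarrow> real \<Rightarrow> nat \<Rightarrow> nat \<Rightarrow> (nat \<Rightarrow> real) \<Rightarrow> real Matrix.mat" where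
  "B_mat \<alpha> \<beta> n N X =
     Matrix.mat n (N + 1) (\<lambda>(j, k). 1 / sqrt (real n) * njacobi \<alpha> \<beta> k (X (j + 1)))"

definition A_mat :: "real \<Rightarrow> real \<Rightarrow> nat \<Rightarrow> nat \<Rightarrow> (nat \<Rightarrow> real) \<Rightarrow> real Matrix.mat" where
  "A_mat \<alpha> \<beta> n N X = transpose_mat (B_mat \<alpha> \<beta> n N X) * B_mat \<alpha> \<beta> n N X"

definition cond2 :: "real Matrix.mat \<Rightarrow> ereal" where
  "cond2 A = (if invertible_mat A then ereal (Max (spectrum A) / Min (spectrum A)) else \<infinity>)"

definition ereal_sqrt :: "ereal \<Rightarrow> ereal" where
  "ereal_sqrt x = (if x = \<infinity> then \<infinity> else ereal (sqrt (real_of_ereal x)))"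

definition lsq_coeffs ::
  "real \<Rightarrow> real \<Rightarrow> nat \<Rightarrow> nat \<Rightarrow> (nat \<Rightarrow> real) \<Rightarrow> (nat \<Rightarrow> real) \<Rightarrow> real Matrix.vec" where
  "lsq_coeffs \<alpha> \<beta> n N X Y =
     (the (mat_inverse (A_mat \<alpha> \<beta> n N X)) * transpose_mat (B_mat \<alpha> \<beta> n N X)) *\<^sub>v
     ((1 / sqrt (real n)) \<cdot>\<^sub>v Matrix.vec n (\<lambda>j. Y (j + 1)))"

definition lsq_estimator ::
  "real \<Rightarrow> real \<Rightarrow> nat \<Rightarrow> nat \<Rightarrow> (nat \<Rightarrow> real) \<Rightarrow> (nat \<Rightarrow> real) \<Rightarrow> real \<Rightarrow> real" where
  "lsq_estimator \<alpha> \<beta> n N X Y x =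
     (\<Sum>k=1..N+1. vec_index (lsq_coeffs \<alpha> \<beta> n N X Y) (k - 1) * njacobi \<alpha> \<beta> (k - 1) x)"

definition centered_law :: "real measure \<Rightarrow> real \<Rightarrow> bool" where
  "centered_law \<nu> \<sigma> \<longleftrightarrow>
     prob_space \<nu> \<and> sets \<nu> = sets borel \<and> integrable \<nu> (\<lambda>x. x\<^sup>2) \<and>
     (LINT x|\<nu>. x) = 0 \<and> (LINT x|\<nu>. x\<^sup>2) = \<sigma>\<^sup>2"

definition beta_density :: "real \<Rightarrow> real \<Rightarrow> real \<Rightarrow> ennreal" where
  "beta_density \<alpha> \<beta> x = ennreal (indicator I x * jweight \<alpha> \<beta> x / beta_const \<alpha> \<beta>)"

text \<open>No assumption is made on the joint behaviour of the design points \<open>X\<close> and the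
  noise \<open>\<epsilon>\<close>.\<close>
definition regression_sample ::
  "real \<Rightarrow> real \<Rightarrow> real measure \<Rightarrow> nat \<Rightarrow> 'a measure \<Rightarrow>
   (nat \<Rightarrow> 'a \<Rightarrow> real) \<Rightarrow> (nat \<Rightarrow> 'a \<Rightarrow> real) \<Rightarrow> bool" where
  "regression_sample \<alpha> \<beta> \<nu> n M X \<epsilon> \<longleftrightarrow>
     prob_space M \<and>
     prob_space.indep_vars M (\<lambda>_. borel) X {1..n} \<and>
     (\<forall>i\<in>{1..n}. distributed M lborel (X i) (beta_density \<alpha> \<beta>)) \<and>
     prob_space.indep_vars M (\<lambda>_. borel) \<epsilon> {1..n} \<and>
     (\<forall>i\<in>{1..n}. distr M borel (\<epsilon> i) = \<nu>)"

end

theory Submission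
  imports Defs
begin

text \<open>The bound is deterministic on the almost sure event that all design points lie in \<open>I\<close>.
  By Jackson's theorem there is a polynomial \<open>P\<close> of degree at most \<open>N\<close> with
  \<open>\<bar>f - P\<bar> \<le> r = O(N powr -(p + \<gamma>))\<close> on \<open>I\<close>. If \<open>d\<close> is the difference of the coefficients of
  the estimator and of \<open>P\<close>, and \<open>w\<close> collects the numbers
  \<open>(f (X j) - P (X j) + \<epsilon> j) / sqrt n\<close>, the normal equations read \<open>A d = B' w\<close>. Hence
  \<open>\<lambda>min \<bar>d\<bar>\<^sup>2 \<le> \<bar>B d\<bar>\<^sup>2 \<le> \<bar>w\<bar>\<^sup>2 \<le> (r + max \<bar>\<epsilon>\<bar>)\<^sup>2\<close>, while \<open>\<lambda>max\<close> is at least the entry of \<open>A\<close>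
  belonging to the constant polynomial, which is \<open>1 / beta_const \<alpha> \<beta>\<close>. So
  \<open>\<bar>d\<bar> \<le> sqrt (\<kappa> * beta_const \<alpha> \<beta>) * (r + max \<bar>\<epsilon>\<bar>)\<close>, and \<open>\<bar>d\<bar>\<close> is the weighted norm of
  \<open>fhat - P\<close> by orthonormality. For large \<open>n\<close> the denominator in the claim lies between \<open>0\<close> and
  \<open>1 / sqrt (beta_const \<alpha> \<beta>)\<close>, so dividing by it only enlarges the bound, and for a singular
  \<open>A\<close> the right-hand side is infinite.\<close>

section \<open>Jackson's theorem\<close>

text \<open>In the variable x = sin t this is the Dirichlet-type ratio sin((2 m + 1) t) / sin t. The
  recursion comes from sin(a + 2 t) + sin(a - 2 t) = 2 cos(2 t) sin a with 2 cos(2 t) = 2 - 4 x^2;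
  the second base case is the triple angle formula.\<close>

fun sin_poly :: "nat \<Rightarrow> real poly" where
  "sin_poly 0 = 1"
| "sin_poly (Suc 0) = [:3, 0, -4:]"
| "sin_poly (Suc (Suc m)) = [:2, 0, -4:] * sin_poly (Suc m) - sin_poly m"

lemma degree_sin_poly: "Polynomial.degree (sin_poly m) \<le> 2 * m"
proof (induction m rule: sin_poly.induct)
  case (3 m)
  have "Polynomial.degree ([:2, 0, -4:] * sin_poly (Suc m)) \<le> 2 + 2 * Suc m"
    using degree_mult_le[of "[:2, 0, -4:]" "sin_poly (Suc m)"] 3(1) by simp
  with 3(2) show ?case
    by (auto intro!: degree_diff_le simp del: mult_pCons_left)
qed auto

lemma poly_sin_poly_0: "poly (sin_poly m) 0 = 2 * real m + 1"
  by (induction m rule: sin_poly.induct) auto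

lemma sin_poly_sin: "poly (sin_poly m) (sin t) * sin t = sin ((2 * real m + 1) * t)"
proof (induction m rule: sin_poly.induct)
  case 2
  have "sin (3 * t) = sin (2 * t + t)" by (simp add: algebra_simps)
  also have "\<dots> = 3 * sin t - 4 * sin t ^ 3"
  proof -
    have cc: "cos t * cos t = 1 - sin t * sin t"
      using sin_cos_squared_add[of t] by (simp add: power2_eq_square)
    have "sin (2 * t + t) = 2 * sin t * (cos t * cos t) + (cos t * cos t - sin t * sin t) * sin t"
      unfolding sin_add sin_double cos_double by (simp only: power2_eq_square mult.assoc)
    then show ?thesis unfolding cc by (simp add: algebra_simps power3_eq_cube)
  qed
  finally show ?case by (simp add: algebra_simps power3_eq_cube)
next
  case (3 m)
  have "sin ((2 * real (Suc (Suc m)) + 1) * t) = sin ((2 * real (Suc m) + 1) * t + 2 * t)"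
       "sin ((2 * real m + 1) * t) = sin ((2 * real (Suc m) + 1) * t - 2 * t)"
    by (simp_all add: algebra_simps)
  then have "sin ((2 * real (Suc (Suc m)) + 1) * t) + sin ((2 * real m + 1) * t)
     = 2 * sin ((2 * real (Suc m) + 1) * t) * cos (2 * t)"
    unfolding sin_add sin_diff by simp
  also have "cos (2 * t) = 1 - 2 * (sin t)\<^sup>2" by (simp add: cos_double_sin)
  finally have "sin ((2 * real (Suc (Suc m)) + 1) * t) =
     2 * sin ((2 * real (Suc m) + 1) * t) * (1 - 2 * (sin t)\<^sup>2) - sin ((2 * real m + 1) * t)"
    by simp
  then show ?case unfolding 3[symmetric] by (simp add: algebra_simps power2_eq_square)
qed simp

lemma abs_sin_mult_le: "\<bar>sin (real n * t)\<bar> \<le> real n * \<bar>sin t\<bar>"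
proof (induction n)
  case (Suc n)
  have "\<bar>sin (real (Suc n) * t)\<bar> = \<bar>sin (real n * t) * cos t + cos (real n * t) * sin t\<bar>"
    using sin_add[of "real n * t" t] by (simp add: algebra_simps)
  also have "\<dots> \<le> \<bar>sin (real n * t)\<bar> * \<bar>cos t\<bar> + \<bar>cos (real n * t)\<bar> * \<bar>sin t\<bar>"
    by (metis abs_mult abs_triangle_ineq)
  also have "\<dots> \<le> \<bar>sin (real n * t)\<bar> * 1 + 1 * \<bar>sin t\<bar>"
    by (intro add_mono mult_mono) auto
  finally show ?case using Suc by (simp add: algebra_simps)
qed simp

text \<open>Let S be the value at x and k = 2 m + 1. The bounds |S| \<le> k and |S x| \<le> 1 are
  squared and added, the second one after multiplication by k^2. This gives a single estimate that
  is effective both near 0 and away from it.\<close>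

lemma sin_poly_sq_le:
  assumes "\<bar>x\<bar> \<le> 1"
  shows "(1 + (2 * real m + 1)\<^sup>2 * x\<^sup>2) * (poly (sin_poly m) x)\<^sup>2 \<le> 2 * (2 * real m + 1)\<^sup>2"
proof -
  define k where "k = 2 * real m + 1"
  define t where "t = arcsin x"
  have x: "x = sin t" using assms by (simp add: t_def)
  define S where "S = poly (sin_poly m) x"
  have S: "S * x = sin (k * t)" unfolding S_def k_def x by (rule sin_poly_sin)
  have k: "k = real (2 * m + 1)" by (simp add: k_def)
  have "(S * x)\<^sup>2 \<le> 1" unfolding S by (simp add: abs_square_le_1)
  then have 1: "x\<^sup>2 * S\<^sup>2 \<le> 1" by (simp add: power_mult_distrib mult.commute)
  have "S\<^sup>2 \<le> k\<^sup>2"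
  proof (cases "x = 0")
    case True
    then show ?thesis using poly_sin_poly_0[of m] by (simp add: S_def k_def)
  next
    case False
    have "\<bar>S\<bar> * \<bar>x\<bar> \<le> k * \<bar>x\<bar>"
      using abs_sin_mult_le[of "2 * m + 1" t] S x unfolding k[symmetric] by (simp add: abs_mult[symmetric])
    with False have "\<bar>S\<bar> \<le> k" by simp
    then show ?thesis by (metis abs_ge_zero power2_abs power_mono)
  qed
  moreover have "k\<^sup>2 * (x\<^sup>2 * S\<^sup>2) \<le> k\<^sup>2 * 1" by (rule mult_left_mono[OF 1]) simp
  ultimately show ?thesis unfolding S_def k_def by (simp only: algebra_simps)
qed

text \<open>The derivative cos u - 1/2 of sin u - u/2 is nonnegative up to pi/3, which exceeds
  1.\<close>

lemma sin_ge_half: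
  assumes "0 \<le> y" "y \<le> (1::real)"
  shows "y / 2 \<le> sin y"
proof -
  have "0 \<le> cos u - 1/2" if "0 \<le> u" "u \<le> y" for u
  proof -
    have "cos (pi/3) \<le> cos u" using that assms pi_gt3 by (intro cos_monotone_0_pi_le) auto
    then show ?thesis by (simp add: cos_60)
  qed
  then have "sin 0 - 0 / 2 \<le> sin y - y / 2"
    by (intro DERIV_nonneg_imp_nondecreasing[OF assms(1), of "\<lambda>u. sin u - u / 2"])
       (auto intro!: derivative_eq_intros exI)
  then show ?thesis by simp
qed

text \<open>With x = sin t and k = 2 m + 1, the smallness of x gives k t \<le> 1. Then sin(k t)
  \<ge> k t / 2 \<ge> k x / 2, and division by x finishes.\<close>

lemma sin_poly_ge:
  assumes "0 \<le> x" "x * (2 * real m + 1) \<le> 1 / 2"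
  shows "poly (sin_poly m) x \<ge> (2 * real m + 1) / 2"
proof (cases "x = 0")
  case True
  then show ?thesis by (simp add: poly_sin_poly_0)
next
  case False
  define k where "k = 2 * real m + 1"
  have k: "k \<ge> 1" by (simp add: k_def)
  define t where "t = arcsin x"
  have x0: "x > 0" using assms False by simp
  have "x * 1 \<le> x * k" using x0 k by (intro mult_left_mono) auto
  with assms(2) have x1: "x \<le> 1/2" by (simp add: k_def)
  have x: "x = sin t" using x1 x0 by (simp add: t_def)
  have t0: "t > 0" using x0 x1 arcsin_less_arcsin[of 0 x] by (simp add: t_def)
  \<comment> \<open>Otherwise pi/6 < 1 < t \<le> pi/2, and monotonicity would give sin t >
    1/2.\<close>
  have "t \<le> 1"
  proof (rule ccontr)
    assume "\<not> t \<le> 1"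
    moreover have "t \<le> pi/2" using x0 x1 arcsin_ubound[of x] by (simp add: t_def)
    ultimately have "sin (pi/6) < sin t" using pi_less_4 by (intro sin_monotone_2pi) auto
    then show False using x x1 by (simp add: sin_30)
  qed
  then have t2: "t \<le> 2 * x" using sin_ge_half[of t] t0 x by simp
  have "k * t \<le> k * (2 * x)" using t2 k by (intro mult_left_mono) auto
  also have "\<dots> \<le> 1" using assms(2) by (simp add: k_def algebra_simps)
  finally have "k * t / 2 \<le> sin (k * t)" using t0 k by (intro sin_ge_half) auto
  also have "\<dots> = poly (sin_poly m) x * x" unfolding k_def x by (rule sin_poly_sin[symmetric])
  finally have *: "k / 2 * t \<le> poly (sin_poly m) x * x" by simp
  have "k / 2 * x \<le> k / 2 * t" using k t0 x sin_x_le_x[of t] by (intro mult_left_mono) auto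
  with * have "k / 2 * x \<le> poly (sin_poly m) x * x" by linarith
  then show ?thesis using x0 by (simp add: k_def)
qed


text \<open>Since \<open>pCons c K\<close> at x - u is c + (x - u) K(x - u), the convolution of g
  with it is a constant, plus x times the convolution of g with K, minus that of u g(u) with K. The
  last term is why g varies in the induction.\<close>

lemma poly_convolution:
  fixes g :: "real \<Rightarrow> real"
  assumes "continuous_on {a..b} g"
  shows "\<exists>Q. Polynomial.degree Q \<le> Polynomial.degree K \<and>
    (\<forall>x. ((\<lambda>u. g u * poly K (x - u)) has_integral poly Q x) {a..b})"
  using assms
proof (induction K arbitrary: g rule: pCons_induct)
  case 0
  show ?case by (rule exI[of _ 0]) simp
next
  case (pCons c K)
  have g: "(g has_integral integral {a..b} g) {a..b}"
    using pCons.prems by (intro integrable_integral integrable_continuous_real)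
  have gc: "((\<lambda>u. g u * c) has_integral integral {a..b} g * c) {a..b}"
    using g by (rule has_integral_mult_left)
  \<comment> \<open>For \<open>K = 0\<close> the degree of \<open>pCons c K\<close> is 0 and not
    \<open>Suc (degree K)\<close>, so this case is separate.\<close>
  show ?case
  proof (cases "K = 0")
    case True
    with gc show ?thesis by (intro exI[of _ "[:integral {a..b} g * c:]"]) simp
  next
    case False
    obtain Q1 where Q1: "Polynomial.degree Q1 \<le> Polynomial.degree K"
      "\<And>x. ((\<lambda>u. g u * poly K (x - u)) has_integral poly Q1 x) {a..b}"
      using pCons.IH[OF pCons.prems] by blast
    have "continuous_on {a..b} (\<lambda>u. u * g u)"
      using pCons.prems by (intro continuous_intros)
    from pCons.IH[OF this] obtain Q2 where Q2: "Polynomial.degree Q2 \<le> Polynomial.degree K"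
      "\<And>x. ((\<lambda>u. u * g u * poly K (x - u)) has_integral poly Q2 x) {a..b}"
      by blast
    define Q where "Q = [:integral {a..b} g * c:] + [:0, 1:] * Q1 - Q2"
    have "Polynomial.degree ([:0, 1:] * Q1) \<le> Suc (Polynomial.degree K)"
      using Q1(1) degree_mult_le[of "[:0, 1:]" Q1] by simp
    then have "Polynomial.degree Q \<le> Polynomial.degree (pCons c K)"
      unfolding Q_def using Q2(1) False
      by (auto intro!: degree_diff_le degree_add_le simp del: mult_pCons_left)
    moreover have "((\<lambda>u. g u * poly (pCons c K) (x - u)) has_integral poly Q x) {a..b}" for x
    proof -
      have "((\<lambda>u. g u * c + x * (g u * poly K (x - u)) - u * g u * poly K (x - u))
        has_integral integral {a..b} g * c + x * poly Q1 x - poly Q2 x) {a..b}"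
        by (intro has_integral_diff has_integral_add gc has_integral_mult_right Q1 Q2)
      moreover have "integral {a..b} g * c + x * poly Q1 x - poly Q2 x = poly Q x"
        by (simp add: Q_def)
      moreover have "(\<lambda>u. g u * c + x * (g u * poly K (x - u)) - u * g u * poly K (x - u)) =
        (\<lambda>u. g u * poly (pCons c K) (x - u))"
        by (simp add: fun_eq_iff algebra_simps)
      ultimately show ?thesis by simp
    qed
    ultimately show ?thesis by blast
  qed
qed

section \<open>The kernel: pointwise bound, mass and first moment\<close>

text \<open>Up to the scaling by \<open>1/4\<close> this is the Jackson-type kernel \<open>(sin ((2 m + 1) s) / sin s) ^ 4\<close> in
  the variable \<open>t = sin s\<close>. The scaling lets \<open>t = x - u\<close> range over \<open>{-4..4}\<close>, as needed for
  \<open>x \<in> I\<close> and \<open>u \<in> {-3..3}\<close>.\<close>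
definition jackson_kernel :: "nat \<Rightarrow> real poly" where
  "jackson_kernel m = pcompose (sin_poly m) [:0, 1/4:] ^ 4"

lemma poly_jackson_kernel: "poly (jackson_kernel m) t = poly (sin_poly m) (t / 4) ^ 4"
  by (simp add: jackson_kernel_def poly_pcompose)

lemma degree_jackson_kernel: "Polynomial.degree (jackson_kernel m) \<le> 8 * m"
proof -
  have "Polynomial.degree (jackson_kernel m) \<le> Polynomial.degree (pcompose (sin_poly m) [:0, 1/4:]) * 4"
    unfolding jackson_kernel_def by (rule degree_power_le)
  also have "\<dots> \<le> Polynomial.degree (sin_poly m) * 4" by simp
  also have "\<dots> \<le> 2 * m * 4" by (intro mult_right_mono degree_sin_poly) simp
  finally show ?thesis by simp
qed

lemma jackson_kernel_nonneg: "poly (jackson_kernel m) t \<ge> 0"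
  by (simp add: poly_jackson_kernel zero_le_even_power)

text \<open>The square of \<open>sin_poly_sq_le\<close> at t/4. Decay of order t^(-4) keeps the
  first moment of order k^2; decay of order t^(-2) would cost a logarithm.\<close>

lemma jackson_kernel_le:
  assumes "\<bar>t\<bar> \<le> 4"
  shows "poly (jackson_kernel m) t \<le>
    4 * (2 * real m + 1) ^ 4 / (1 + ((2 * real m + 1) * t / 4)\<^sup>2)\<^sup>2"
proof -
  define k where "k = 2 * real m + 1"
  have pos: "1 + (k * t / 4)\<^sup>2 > 0" by (simp add: add_pos_nonneg)
  have "(1 + k\<^sup>2 * (t/4)\<^sup>2) * (poly (sin_poly m) (t/4))\<^sup>2 \<le> 2 * k\<^sup>2"
    unfolding k_def using assms by (intro sin_poly_sq_le) auto
  then have "(poly (sin_poly m) (t/4))\<^sup>2 \<le> 2 * k\<^sup>2 / (1 + (k * t / 4)\<^sup>2)"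
    using pos by (simp add: field_simps)
  then have "((poly (sin_poly m) (t/4))\<^sup>2)\<^sup>2 \<le> (2 * k\<^sup>2 / (1 + (k * t / 4)\<^sup>2))\<^sup>2"
    by (intro power_mono) auto
  also have "\<dots> = 4 * k ^ 4 / (1 + (k * t / 4)\<^sup>2)\<^sup>2"
    by (simp add: power_divide power_mult_distrib)
  finally show ?thesis by (simp add: poly_jackson_kernel k_def)
qed

text \<open>The mass on [0, 2/k] suffices: there \<open>sin_poly_ge\<close> bounds the kernel below
  by (k/2)^4.\<close>

lemma jackson_kernel_integral_ge:
  "(2 * real m + 1) ^ 3 / 8 \<le> integral {-4..4} (poly (jackson_kernel m))"
proof -
  define k where "k = 2 * real m + 1"
  have k: "k \<ge> 1" by (simp add: k_def)
  have int: "poly (jackson_kernel m) integrable_on {a..b}" for a b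
    by (intro integrable_continuous_real continuous_intros)
  have "(k / 2) ^ 4 \<le> poly (jackson_kernel m) t" if "t \<in> {0..2/k}" for t
  proof -
    have "t / 4 * k \<le> 1 / 2" using that k by (simp add: field_simps)
    then have "k / 2 \<le> poly (sin_poly m) (t / 4)"
      unfolding k_def using that by (intro sin_poly_ge) (auto simp: k_def)
    then show ?thesis unfolding poly_jackson_kernel using k by (intro power_mono) auto
  qed
  then have "integral {0..2/k} (\<lambda>_. (k / 2) ^ 4) \<le> integral {0..2/k} (poly (jackson_kernel m))"
    by (intro integral_le int) auto
  also have "\<dots> \<le> integral {-4..4} (poly (jackson_kernel m))"
    using k by (intro integral_subset_le int) (auto simp: jackson_kernel_nonneg field_simps)
  finally have "2 / k * (k / 2) ^ 4 \<le> integral {-4..4} (poly (jackson_kernel m))" using k by simp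
  moreover have "2 / k * (k / 2) ^ 4 = k ^ 3 / 8"
    using k by (simp add: field_simps power_numeral_reduce)
  ultimately show ?thesis by (simp only: k_def)
qed

text \<open>Times t, the bound of \<open>jackson_kernel_le\<close> has the explicit antiderivative
  \<open>F\<close>, whose increase over [0, 4] is at most 32 k^2. Reflection gives the same for the
  other half.\<close>

lemma jackson_kernel_moment_le:
  "integral {-4..4} (\<lambda>t. \<bar>t\<bar> * poly (jackson_kernel m) t) \<le> 64 * (2 * real m + 1)\<^sup>2"
proof -
  define k where "k = 2 * real m + 1"
  have k: "k \<ge> 1" by (simp add: k_def)
  define G where "G t = t * (4 * k ^ 4 / (1 + (k * t / 4)\<^sup>2)\<^sup>2)" for t
  define F where "F t = - (32 * k\<^sup>2 / (1 + (k * t / 4)\<^sup>2))" for t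
  have int: "(\<lambda>t. \<bar>t\<bar> * poly (jackson_kernel m) t) integrable_on {a..b}" for a b
    by (intro integrable_continuous_real continuous_intros)
  have "(F has_real_derivative G t) (at t)" for t
  proof -
    have pos: "1 + (k * t / 4)\<^sup>2 > 0" by (simp add: add_pos_nonneg)
    then show ?thesis unfolding F_def G_def
      by (auto intro!: derivative_eq_intros simp: power2_eq_square power4_eq_xxxx)
         (simp add: field_simps)?
  qed
  then have "(G has_integral F 4 - F 0) {0..4}"
    by (intro fundamental_theorem_of_calculus)
       (auto simp: has_real_derivative_iff_has_vector_derivative[symmetric] intro: has_field_derivative_at_within)
  moreover have "F 4 - F 0 \<le> 32 * k\<^sup>2" by (simp add: F_def)
  ultimately obtain J where J: "(G has_integral J) {0..4}" "J \<le> 32 * k\<^sup>2" by blast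
  have pos: "(\<lambda>t. \<bar>t\<bar> * poly (jackson_kernel m) t) t \<le> G t" if "t \<in> {0..4}" for t
    using that mult_left_mono[OF jackson_kernel_le[of t m], of t] by (simp add: G_def k_def)
  have 1: "integral {0..4} (\<lambda>t. \<bar>t\<bar> * poly (jackson_kernel m) t) \<le> J"
    using J(1) by (intro has_integral_le[OF integrable_integral[OF int] J(1)] pos)
  have J': "((\<lambda>t. G (- t)) has_integral J) {-4..0}"
    using J(1) has_integral_reflect_real[of G J 4 0] by simp
  have neg: "(\<lambda>t. \<bar>t\<bar> * poly (jackson_kernel m) t) t \<le> G (- t)" if "t \<in> {-4..0}" for t
  proof -
    have "(k * - t / 4)\<^sup>2 = (k * t / 4)\<^sup>2" by (simp add: power2_eq_square)
    then show ?thesis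
      using that mult_left_mono[OF jackson_kernel_le[of t m], of "-t"]
      by (simp only: G_def k_def[symmetric]) simp
  qed
  have 2: "integral {-4..0} (\<lambda>t. \<bar>t\<bar> * poly (jackson_kernel m) t) \<le> J"
    by (intro has_integral_le[OF integrable_integral[OF int] J'] neg)
  have "integral {-4..4} (\<lambda>t. \<bar>t\<bar> * poly (jackson_kernel m) t) =
    integral {-4..0} (\<lambda>t. \<bar>t\<bar> * poly (jackson_kernel m) t) +
    integral {0..4} (\<lambda>t. \<bar>t\<bar> * poly (jackson_kernel m) t)"
    by (rule Henstock_Kurzweil_Integration.integral_combine[symmetric]) (auto intro: int)
  with 1 2 J(2) show ?thesis by (simp add: k_def)
qed

text \<open>\<open>f - f 0\<close> is extended by constants and cut off outside \<open>{-2..2}\<close>, so that its convolution with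
  the kernel is an integral over the fixed interval \<open>{-3..3}\<close>, hence a polynomial. The
  constant is \<open>3 * (1 + 512)\<close>: a factor \<open>3\<close> from the cut-off, and \<open>512\<close> from the first moment of
  the kernel.\<close>
lemma jackson_modulus:
  fixes f :: "real \<Rightarrow> real"
  defines "k \<equiv> \<lambda>m. 2 * real m + 1"
  assumes cont: "continuous_on I f"
    and modulus: "\<And>x y. x \<in> I \<Longrightarrow> y \<in> I \<Longrightarrow> \<bar>f x - f y\<bar> \<le> w * (1 + k m * \<bar>x - y\<bar>)"
  shows "\<exists>P. Polynomial.degree P \<le> 8 * m \<and> (\<forall>x\<in>I. \<bar>f x - poly P x\<bar> \<le> 1539 * w)"
proof -
  define K where "K = poly (jackson_kernel m)"
  define c where "c = integral {-4..4} K"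
  have k1: "k m \<ge> 1" by (simp add: k_def)
  have w0: "w \<ge> 0" using modulus[of 0 0] by simp
  define cl where "cl u = max (-1) (min 1 u)" for u :: real
  \<comment> \<open>Subtracting \<open>f 0\<close> makes g bounded by a multiple of w, so the
    cut-off does not bring in the size of f.\<close>
  define g where "g u = f (cl u) - f 0" for u
  define v where "v u = max 0 (min 1 (2 - \<bar>u\<bar>))" for u :: real
  define F where "F u = g u * v u" for u
  have clI: "cl u \<in> I" for u by (auto simp: cl_def)
  have g_diff: "\<bar>g x - g y\<bar> \<le> w * (1 + k m * \<bar>x - y\<bar>)" for x y
  proof -
    have "\<bar>cl x - cl y\<bar> \<le> \<bar>x - y\<bar>" by (auto simp: cl_def)
    then have "w * (1 + k m * \<bar>cl x - cl y\<bar>) \<le> w * (1 + k m * \<bar>x - y\<bar>)"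
      using w0 k1 by (intro mult_left_mono add_left_mono) auto
    with modulus[OF clI clI, of x y] show ?thesis by (simp add: g_def)
  qed
  have g_le: "\<bar>g x\<bar> \<le> w * (2 * k m)" for x
  proof -
    have "\<bar>g x\<bar> \<le> w * (1 + k m * \<bar>cl x - 0\<bar>)" unfolding g_def by (intro modulus clI) auto
    also have "\<dots> \<le> w * (1 + k m * 1)"
      using w0 k1 by (intro mult_left_mono add_left_mono) (auto simp: cl_def)
    also have "\<dots> \<le> w * (2 * k m)" using w0 k1 by (intro mult_left_mono) auto
    finally show ?thesis .
  qed
  have v_diff: "\<bar>v x - v y\<bar> \<le> \<bar>x - y\<bar>" for x y unfolding v_def by (smt (verit))
  have v01: "0 \<le> v x" "v x \<le> 1" for x by (auto simp: v_def)
  \<comment> \<open>The difference of g contributes w (1 + k |x - y|); the cut-off, being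
    1-Lipschitz, contributes the supremum 2 k w of g times |x - y|.\<close>
  have F_diff: "\<bar>F x - F y\<bar> \<le> 3 * w * (1 + k m * \<bar>x - y\<bar>)" for x y
  proof -
    have "F x - F y = (g x - g y) * v y + g x * (v x - v y)" by (simp add: F_def algebra_simps)
    then have "\<bar>F x - F y\<bar> \<le> \<bar>g x - g y\<bar> * \<bar>v y\<bar> + \<bar>g x\<bar> * \<bar>v x - v y\<bar>"
      by (metis abs_mult abs_triangle_ineq)
    also have "\<dots> \<le> w * (1 + k m * \<bar>x - y\<bar>) * 1 + w * (2 * k m) * \<bar>x - y\<bar>"
      using w0 k1 v01[of y] by (intro add_mono mult_mono g_diff g_le v_diff) auto
    also have "\<dots> \<le> 3 * w * (1 + k m * \<bar>x - y\<bar>)" using w0 by (simp add: algebra_simps)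
    finally show ?thesis .
  qed
  have F_0: "F u = 0" if "\<bar>u\<bar> \<ge> 2" for u using that by (auto simp: F_def v_def)
  have F_eq: "F x = f x - f 0" if "x \<in> I" for x
    using that by (auto simp: F_def v_def g_def cl_def max_def min_def)
  have contF: "continuous_on A F" for A
    unfolding F_def g_def v_def
    by (intro continuous_intros continuous_on_compose2[OF cont]) (auto simp: cl_def intro!: continuous_intros)
  have contK: "continuous_on A K" for A unfolding K_def by (intro continuous_intros)
  obtain Q where Q: "Polynomial.degree Q \<le> Polynomial.degree (jackson_kernel m)"
    and Q': "\<And>x. ((\<lambda>u. F u * K (x - u)) has_integral poly Q x) {-3..3}"
    using poly_convolution[OF contF, where a = "-3" and b = 3 and K = "jackson_kernel m"] unfolding K_def by blast
  have c: "k m ^ 3 / 8 \<le> c" unfolding c_def K_def k_def by (rule jackson_kernel_integral_ge)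
  moreover have "k m ^ 3 > 0" using k1 by simp
  ultimately have c0: "c > 0" by linarith
  have "k m * integral {-4..4} (\<lambda>t. \<bar>t\<bar> * K t) \<le> k m * (64 * (k m)\<^sup>2)"
    using k1 unfolding K_def k_def by (intro mult_left_mono jackson_kernel_moment_le) auto
  also have "\<dots> = 64 * k m ^ 3" by (simp add: power2_eq_square power3_eq_cube)
  finally have mom: "k m * integral {-4..4} (\<lambda>t. \<bar>t\<bar> * K t) \<le> 512 * c" using c by simp
  have K_int: "(K has_integral c) {-4..4}"
    unfolding c_def by (intro integrable_integral integrable_continuous_real contK)
  have main: "\<bar>F x - poly Q x / c\<bar> \<le> 1539 * w" if x: "x \<in> I" for x
  proof -
    have "((\<lambda>u. F (- u) * K (x + u)) has_integral poly Q x) {-3..3}"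
      using Q'[of x] has_integral_reflect_real[of "\<lambda>u. F u * K (x - u)" "poly Q x" 3 "-3"] by simp
    from has_integral_affinity'[OF this[folded box_real], of 1 "-x"]
    have "((\<lambda>t. F (x - t) * K t) has_integral poly Q x) {-3 + x..3 + x}"
      by simp
    \<comment> \<open>Outside [x - 3, x + 3] the argument x - t has modulus above 3, where
      \<open>F\<close> vanishes, so the domain can be enlarged to one that no longer depends on
      x.\<close>
    then have "((\<lambda>t. F (x - t) * K t) has_integral poly Q x) {-4..4}"
      by (rule has_integral_on_superset) (use x in \<open>auto intro!: F_0\<close>)
    from has_integral_diff[OF has_integral_mult_right[OF K_int, of "F x"] this]
    have 1: "((\<lambda>t. (F x - F (x - t)) * K t) has_integral F x * c - poly Q x) {-4..4}"
      by (simp add: algebra_simps)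
    have 2: "((\<lambda>t. 3 * w * K t + 3 * w * k m * (\<bar>t\<bar> * K t)) has_integral
      3 * w * c + 3 * w * k m * integral {-4..4} (\<lambda>t. \<bar>t\<bar> * K t)) {-4..4}"
      by (intro has_integral_add has_integral_mult_right K_int integrable_integral
          integrable_continuous_real continuous_intros contK)
    have "norm ((F x - F (x - t)) * K t) \<le> 3 * w * K t + 3 * w * k m * (\<bar>t\<bar> * K t)" for t
    proof -
      have "\<bar>F x - F (x - t)\<bar> * K t \<le> 3 * w * (1 + k m * \<bar>x - (x - t)\<bar>) * K t"
        by (intro mult_right_mono F_diff) (simp add: K_def jackson_kernel_nonneg)
      moreover have "norm ((F x - F (x - t)) * K t) = \<bar>F x - F (x - t)\<bar> * K t"
        unfolding real_norm_def abs_mult by (simp add: K_def jackson_kernel_nonneg)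
      ultimately show ?thesis by (simp add: algebra_simps)
    qed
    then have "norm (integral {-4..4} (\<lambda>t. (F x - F (x - t)) * K t)) \<le>
      integral {-4..4} (\<lambda>t. 3 * w * K t + 3 * w * k m * (\<bar>t\<bar> * K t))"
      using 1 2 by (intro integral_norm_bound_integral) (auto simp: has_integral_integrable)
    then have "\<bar>F x * c - poly Q x\<bar> \<le> 3 * w * c + 3 * w * (k m * integral {-4..4} (\<lambda>t. \<bar>t\<bar> * K t))"
      using integral_unique[OF 1] integral_unique[OF 2] by (simp add: mult.assoc)
    also have "\<dots> \<le> 3 * w * c + 3 * w * (512 * c)"
      using w0 mom by (intro add_left_mono mult_left_mono) auto
    also have "\<dots> = 1539 * w * c" by simp
    finally have "\<bar>F x * c - poly Q x\<bar> / c \<le> 1539 * w" using c0 by (simp add: field_simps)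
    moreover have "F x - poly Q x / c = (F x * c - poly Q x) / c" using c0 by (simp add: field_simps)
    ultimately show ?thesis using c0 by simp
  qed
  let ?P = "[:f 0:] + Polynomial.smult (1 / c) Q"
  have "Polynomial.degree ?P \<le> 8 * m"
    using Q degree_jackson_kernel[of m] by (intro degree_add_le) auto
  moreover have "\<bar>f x - poly ?P x\<bar> \<le> 1539 * w" if "x \<in> I" for x
    using main[OF that] F_eq[OF that] by (simp add: algebra_simps)
  ultimately show ?thesis by blast
qed


section \<open>Approximation rates for Hoelder continuous and smooth functions\<close>

lemma powr_le_one_plus:
  fixes z :: real
  assumes "0 \<le> z" "0 < c" "c \<le> 1"
  shows "z powr c \<le> 1 + z"
proof (cases "z \<le> 1")
  case True
  then have "z powr c \<le> 1" using assms by (intro powr_le1) auto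
  then show ?thesis using assms by simp
next
  case False
  then have "z powr c \<le> z powr 1" using assms by (intro powr_mono) auto
  then show ?thesis using False by simp
qed

text \<open>By z^c \<le> 1 + z at z = k |x - y|, the Hoelder condition yields the hypothesis of
  \<open>jackson_modulus\<close> with w = L / k^c. For \<open>m = N div 8\<close> the degree 8 m is
  at most N, and N + 1 \<le> 8 k. Passing from k to N + 1 costs 8^c \<le> 8, and 12312 = 8 *
  1539.\<close>

lemma jackson_Hoelder:
  fixes f :: "real \<Rightarrow> real"
  assumes cont: "continuous_on I f" and c: "0 < c" "c \<le> 1" and L: "L \<ge> 0"
    and hoelder: "\<And>x y. x \<in> I \<Longrightarrow> y \<in> I \<Longrightarrow> \<bar>f x - f y\<bar> \<le> L * \<bar>x - y\<bar> powr c"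
  shows "\<exists>P. Polynomial.degree P \<le> N \<and> (\<forall>x\<in>I. \<bar>f x - poly P x\<bar> \<le> 12312 * L / real (N + 1) powr c)"
proof -
  define m where "m = N div 8"
  define k where "k = 2 * real m + 1"
  have k: "k \<ge> 1" by (simp add: k_def)
  have "N + 1 \<le> 8 * (2 * m + 1)" unfolding m_def by presburger
  then have "real (N + 1) \<le> real (8 * (2 * m + 1))" by (rule of_nat_mono)
  then have kN: "real (N + 1) \<le> 8 * k" by (simp add: k_def)
  have w: "L / k powr c \<le> 8 * L / real (N + 1) powr c"
  proof -
    have "real (N + 1) powr c \<le> (8 * k) powr c" using kN c by (intro powr_mono2) auto
    also have "\<dots> = 8 powr c * k powr c" using k by (simp add: powr_mult)
    also have "\<dots> \<le> 8 powr 1 * k powr c" using c by (intro mult_right_mono powr_mono) auto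
    finally have "L * real (N + 1) powr c \<le> L * (8 * k powr c)" using L by (intro mult_left_mono) auto
    then show ?thesis using k by (simp add: field_simps)
  qed
  have "\<bar>f x - f y\<bar> \<le> L / k powr c * (1 + k * \<bar>x - y\<bar>)" if "x \<in> I" "y \<in> I" for x y
  proof -
    have "k powr c * \<bar>x - y\<bar> powr c = (k * \<bar>x - y\<bar>) powr c" using k by (simp add: powr_mult)
    also have "\<dots> \<le> 1 + k * \<bar>x - y\<bar>" using c k by (intro powr_le_one_plus) auto
    finally have "\<bar>x - y\<bar> powr c \<le> (1 + k * \<bar>x - y\<bar>) / k powr c"
      using k by (simp add: field_simps)
    then have "L * \<bar>x - y\<bar> powr c \<le> L * ((1 + k * \<bar>x - y\<bar>) / k powr c)"
      using L by (intro mult_left_mono) auto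
    with hoelder[OF that] show ?thesis by simp
  qed
  from jackson_modulus[OF cont, of "L / k powr c" m] this obtain P where
    "Polynomial.degree P \<le> 8 * m" "\<And>x. x \<in> I \<Longrightarrow> \<bar>f x - poly P x\<bar> \<le> 1539 * (L / k powr c)"
    unfolding k_def by blast
  moreover have "8 * m \<le> N" by (simp add: m_def)
  moreover have "1539 * (L / k powr c) \<le> 12312 * L / real (N + 1) powr c" using w by simp
  ultimately show ?thesis by (meson order_trans)
qed

lemma poly_antiderivative:
  fixes q :: "real poly"
  shows "\<exists>Q. pderiv Q = q \<and> Polynomial.degree Q \<le> Suc (Polynomial.degree q)"
proof (intro exI conjI)
  let ?Q = "\<Sum>i\<le>Polynomial.degree q. Polynomial.monom (Polynomial.coeff q i / real (Suc i)) (Suc i)"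
  have "pderiv ?Q = (\<Sum>i\<le>Polynomial.degree q. Polynomial.monom (Polynomial.coeff q i) i)"
    by (simp add: pderiv_sum pderiv_monom del: of_nat_Suc)
  then show "pderiv ?Q = q" by (simp add: poly_as_sum_of_monoms)
  show "Polynomial.degree ?Q \<le> Suc (Polynomial.degree q)"
    by (rule degree_sum_le) (auto intro: order_trans[OF degree_monom_le])
qed

text \<open>Induction on \<open>p\<close>: subtracting an antiderivative of a good approximation of \<open>f'\<close> leaves a
  Lipschitz function with a small constant.\<close>
theorem jackson_cont_derivs:
  assumes "cont_derivs p f D" "D p \<in> Lip c" and c: "0 < c" "c \<le> 1"
  shows "\<exists>C\<ge>0. \<forall>N\<ge>p. \<exists>P. Polynomial.degree P \<le> N \<and>
    (\<forall>x\<in>I. \<bar>f x - poly P x\<bar> \<le> C / real (N + 1) powr (real p + c))"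
  using assms(1,2)
proof (induction p arbitrary: f D)
  case 0
  have f: "f x = D 0 x" if "x \<in> I" for x using 0(1) that by (simp add: cont_derivs_def)
  have "continuous_on I (D 0)" using 0(1) by (simp add: cont_derivs_def)
  then have cont: "continuous_on I f" using f by (simp cong: continuous_on_cong_simp)
  obtain L where L: "\<And>x y. x \<in> I \<Longrightarrow> y \<in> I \<Longrightarrow> \<bar>D 0 x - D 0 y\<bar> \<le> L * \<bar>x - y\<bar> powr c"
    using 0(2) unfolding Lip_def by blast
  have "\<bar>f x - f y\<bar> \<le> max L 0 * \<bar>x - y\<bar> powr c" if "x \<in> I" "y \<in> I" for x y
  proof -
    have "L * \<bar>x - y\<bar> powr c \<le> max L 0 * \<bar>x - y\<bar> powr c" by (intro mult_right_mono) auto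
    with L[OF that] show ?thesis unfolding f[OF that(1)] f[OF that(2)] by linarith
  qed
  from jackson_Hoelder[OF cont c _ this]
  show ?case by (intro exI[of _ "12312 * max L 0"]) auto
next
  case (Suc p)
  have "cont_derivs p (D 1) (\<lambda>k. D (Suc k))" using Suc.prems(1) by (simp add: cont_derivs_def)
  from Suc.IH[OF this] Suc.prems(2) obtain C where C0: "C \<ge> 0"
    and C: "\<And>n. n \<ge> p \<Longrightarrow> \<exists>q. Polynomial.degree q \<le> n \<and>
      (\<forall>x\<in>I. \<bar>D 1 x - poly q x\<bar> \<le> C / real (n + 1) powr (real p + c))"
    by blast
  define a where "a = real p + c"
  have "\<exists>P. Polynomial.degree P \<le> N \<and>
    (\<forall>x\<in>I. \<bar>f x - poly P x\<bar> \<le> 12312 * C * 2 powr a / real (N + 1) powr (real (Suc p) + c))"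
    if N: "N \<ge> Suc p" for N
  proof -
    \<comment> \<open>The antiderivative raises the degree by one, so the derivative is approximated
      in degree N - 1. Over the p steps of the induction this accounts for the condition that N is
      at least p.\<close>
    obtain n where n: "N = Suc n" "n \<ge> p" using N by (cases N) auto
    define e where "e = C / real N powr a"
    have e0: "e \<ge> 0" using C0 by (simp add: e_def)
    obtain q where q: "Polynomial.degree q \<le> n" "\<And>x. x \<in> I \<Longrightarrow> \<bar>D 1 x - poly q x\<bar> \<le> e"
      using C[OF n(2)] n(1) by (auto simp: e_def a_def)
    obtain Q where Q: "pderiv Q = q" "Polynomial.degree Q \<le> Suc (Polynomial.degree q)"
      using poly_antiderivative by blast
    define h where "h x = D 0 x - poly Q x" for x
    have deriv: "(h has_field_derivative D 1 x - poly q x) (at x within I)" if "x \<in> I" for x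
      using Suc.prems(1) that unfolding h_def cont_derivs_def Q(1)[symmetric]
      by (intro DERIV_diff has_field_derivative_at_within[OF poly_DERIV]) auto
    then have cont: "continuous_on I h" by (rule DERIV_continuous_on)
    \<comment> \<open>The interval is convex, so a bound on the derivative is a Lipschitz constant.
      This is the exponent 1 in \<open>jackson_Hoelder\<close>.\<close>
    have "\<bar>h x - h y\<bar> \<le> e * \<bar>x - y\<bar> powr 1" if "x \<in> I" "y \<in> I" for x y
      using field_differentiable_bound[of I h "\<lambda>x. D 1 x - poly q x" e x y] deriv q(2) that
      by simp
    from jackson_Hoelder[OF cont _ _ e0 this, of N] obtain P where
      P: "Polynomial.degree P \<le> N" "\<And>x. x \<in> I \<Longrightarrow> \<bar>h x - poly P x\<bar> \<le> 12312 * e / real (N + 1)"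
      by (auto simp del: atLeastAtMost_iff)
    \<comment> \<open>The error for the derivative is a power of N, the new one a power of N + 1;
      the change costs the factor 2^a.\<close>
    have "real (N + 1) powr a \<le> (2 * real N) powr a" using n c by (intro powr_mono2) (auto simp: a_def)
    also have "\<dots> = 2 powr a * real N powr a" by (simp add: powr_mult)
    finally have "C * real (N + 1) powr a \<le> C * (2 powr a * real N powr a)" using C0 by (intro mult_left_mono)
    moreover have "real N > 0" using n by simp
    ultimately have e: "e \<le> C * 2 powr a / real (N + 1) powr a" unfolding e_def
      by (simp add: field_simps)
    have "12312 * e / real (N + 1) \<le> 12312 * (C * 2 powr a / real (N + 1) powr a) / real (N + 1)"
      using e by (intro divide_right_mono mult_left_mono) auto
    also have "\<dots> = 12312 * C * 2 powr a / real (N + 1) powr (real (Suc p) + c)"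
    proof -
      have "real (Suc p) + c = a + 1" by (simp add: a_def)
      then have "real (N + 1) powr (real (Suc p) + c) = real (N + 1) powr a * real (N + 1)"
        using powr_add[of "real (N + 1)" a 1] by (simp del: of_nat_add of_nat_Suc)
      then show ?thesis by simp
    qed
    finally have "\<bar>f x - poly (P + Q) x\<bar> \<le> 12312 * C * 2 powr a / real (N + 1) powr (real (Suc p) + c)"
      if "x \<in> I" for x
      using P(2)[OF that] Suc.prems(1) that by (simp add: h_def cont_derivs_def algebra_simps)
    moreover have "Polynomial.degree (P + Q) \<le> N"
      using P(1) Q(2) q(1) n by (intro degree_add_le) auto
    ultimately show ?thesis by blast
  qed
  then show ?case using C0 by (intro exI[of _ "12312 * C * 2 powr a"]) auto
qed

section \<open>Orthonormality of the Jacobi polynomials\<close>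

lemma jweight_nonneg: "jweight a b x \<ge> 0"
  by (simp add: jweight_def)

lemma jweight_measurable [measurable]: "jweight a b \<in> borel_measurable borel"
  unfolding jweight_def by measurable

text \<open>The substitution t = (1 + x) / 2 in the Beta integral. The exponents change places
  because b belongs to 1 + x.\<close>

lemma jweight_has_integral:
  assumes "a > -1" "b > -1"
  shows "(jweight a b has_integral beta_const a b) I"
proof -
  have "((\<lambda>t. t powr b * (1 - t) powr a) has_integral Beta (b + 1) (a + 1)) {0..1}"
    using has_integral_Beta_real[of "b + 1" "a + 1"] assms by simp
  from has_integral_affinity'[OF this[folded box_real], of "1/2" "1/2"]
  have "((\<lambda>x. (x / 2 + 1/2) powr b * (1 - (x / 2 + 1/2)) powr a) has_integral 2 * Beta (b + 1) (a + 1)) I"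
    by (simp add: field_simps)
  from has_integral_mult_right[OF this, of "2 powr (a + b)"]
  have *: "((\<lambda>x. 2 powr (a + b) * ((x / 2 + 1/2) powr b * (1 - (x / 2 + 1/2)) powr a))
    has_integral 2 powr (a + b) * (2 * Beta (b + 1) (a + 1))) I" .
  have "2 powr (a + b) * (2 * Beta (b + 1) (a + 1)) = beta_const a b"
    by (simp add: beta_const_def powr_add Beta_commute[of "b + 1"])
  moreover have "2 powr (a + b) * ((x / 2 + 1/2) powr b * (1 - (x / 2 + 1/2)) powr a) = jweight a b x"
    if "x \<in> I" for x
  proof -
    have "x / 2 + 1/2 = (1 + x) / 2" "1 - (1 + x) / 2 = (1 - x) / 2" by (simp_all add: field_simps)
    then show ?thesis using that by (simp only: jweight_def powr_divide powr_add) (simp add: powr_divide)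
  qed
  ultimately show ?thesis using * has_integral_cong by (metis (no_types, lifting))
qed

lemma beta_const_pos:
  assumes "a > -1" "b > -1"
  shows "beta_const a b > 0"
  using assms by (simp add: beta_const_def Beta_def Gamma_real_pos)

text \<open>Nonnegativity makes the integral absolute, and Borel measurability brings it from the
  completed measure down to \<open>lborel\<close>.\<close>

lemma jweight_set_integrable:
  assumes "a > -1" "b > -1"
  shows "set_integrable lborel I (jweight a b)"
proof -
  have "jweight a b absolutely_integrable_on I"
    using jweight_has_integral[OF assms]
    by (intro nonnegative_absolutely_integrable_1) (auto simp: jweight_nonneg has_integral_integrable)
  then show ?thesis
    unfolding set_integrable_def by (subst (asm) integrable_completion) auto
qed

lemma continuous_jweight_set_integrable:
  assumes "a > -1" "b > -1" "continuous_on I h"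
  shows "set_integrable lborel I (\<lambda>x. h x * jweight a b x)"
proof -
  have "compact (h ` I)" using assms(3) by (intro compact_continuous_image) auto
  then obtain M where M: "\<And>x. x \<in> I \<Longrightarrow> \<bar>h x\<bar> \<le> M"
    by (meson compact_imp_bounded bounded_real imageI)
  have int: "integrable lborel (\<lambda>x. M * (indicator I x *\<^sub>R jweight a b x))"
    using jweight_set_integrable[OF assms(1,2)] unfolding set_integrable_def by simp
  have meas: "(\<lambda>x. indicator I x *\<^sub>R (h x * jweight a b x)) \<in> borel_measurable lborel"
  proof -
    have [measurable]: "(\<lambda>x. indicator I x *\<^sub>R h x) \<in> borel_measurable borel"
      using assms(3) by (intro borel_measurable_continuous_on_indicator) auto
    have "(\<lambda>x. indicator I x *\<^sub>R h x * jweight a b x) \<in> borel_measurable lborel" by measurable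
    then show ?thesis by (simp add: mult.assoc)
  qed
  have bound: "norm (indicator I x *\<^sub>R (h x * jweight a b x)) \<le> norm (M * (indicator I x *\<^sub>R jweight a b x))" for x
  proof (cases "x \<in> I")
    case True
    have "\<bar>h x\<bar> * jweight a b x \<le> M * jweight a b x"
      using M[OF True] by (intro mult_right_mono jweight_nonneg)
    also have "\<dots> \<le> \<bar>M * jweight a b x\<bar>" by simp
    finally show ?thesis using True by (simp add: abs_mult jweight_nonneg)
  qed simp
  show ?thesis unfolding set_integrable_def
    by (rule Bochner_Integration.integrable_bound[OF int meas AE_I2[OF bound]])
qed

lemma jweight_poly_integrable:
  assumes "a > -1" "b > -1"
  shows "(\<lambda>x. jweight a b x * poly g x) integrable_on I"
  using set_borel_integral_eq_integral(1)[OF continuous_jweight_set_integrable[OF assms, of "poly g"]]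
  by (simp add: mult.commute continuous_intros)

section \<open>Rodrigues' formula in polynomial form\<close>

text \<open>The polynomial factor of the \<open>j\<close>-th derivative of \<open>jweight a b\<close>; see \<open>rodrigues_poly_deriv\<close>.\<close>
primrec rodrigues_poly :: "real \<Rightarrow> real \<Rightarrow> nat \<Rightarrow> real poly" where
  "rodrigues_poly a b 0 = 1"
| "rodrigues_poly a b (Suc j) =
    Polynomial.smult (real j - a) ([:1, 1:] * rodrigues_poly a b j) +
    Polynomial.smult (b - real j) ([:1, -1:] * rodrigues_poly a b j) +
    [:1, 0, -1:] * pderiv (rodrigues_poly a b j)"

text \<open>Differentiation lowers both exponents by one; the factors 1 - x and 1 + x left over in
  each term of the product rule go into the next polynomial.\<close>

lemma rodrigues_poly_deriv:
  assumes "x \<in> {-1<..<1}"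
  shows "((\<lambda>x. jweight (a - real j) (b - real j) x * poly (rodrigues_poly a b j) x)
    has_real_derivative jweight (a - real (Suc j)) (b - real (Suc j)) x * poly (rodrigues_poly a b (Suc j)) x) (at x)"
proof -
  have pos: "1 - x > 0" "1 + x > 0" using assms by auto
  define A where "A = (1 - x) powr (a - real (Suc j))"
  define B where "B = (1 + x) powr (b - real (Suc j))"
  have A: "(1 - x) powr (a - real j) = A * (1 - x)"
    using pos powr_add[of "1 - x" "a - real (Suc j)" 1] by (simp add: A_def)
  have B: "(1 + x) powr (b - real j) = B * (1 + x)"
    using pos powr_add[of "1 + x" "b - real (Suc j)" 1] by (simp add: B_def)
  have A': "(1 - x) powr (a - real j - 1) = A" "(1 + x) powr (b - real j - 1) = B"
    by (simp_all add: A_def B_def algebra_simps)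
  have "((\<lambda>x. (1 - x) powr (a - real j) * (1 + x) powr (b - real j) * poly (rodrigues_poly a b j) x)
      has_field_derivative A * B * poly (rodrigues_poly a b (Suc j)) x) (at x)"
    using pos
    by (auto intro!: derivative_eq_intros simp: A' A B powr_diff[symmetric])
       (simp add: algebra_simps)
  then show ?thesis by (simp add: jweight_def A_def B_def)
qed

lemma funpow_deriv_jweight:
  assumes g: "\<And>x. x \<in> {-1<..<1} \<Longrightarrow> g x = jweight a b x" and "x \<in> {-1<..<1}"
  shows "(deriv ^^ j) g x = jweight (a - real j) (b - real j) x * poly (rodrigues_poly a b j) x"
  using assms(2)
proof (induction j arbitrary: x)
  case 0
  then show ?case by (simp add: g)
next
  case (Suc j)
  have "((deriv ^^ j) g has_field_derivative
    jweight (a - real (Suc j)) (b - real (Suc j)) x * poly (rodrigues_poly a b (Suc j)) x) (at x)"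
    by (rule has_field_derivative_transform_within_open[OF rodrigues_poly_deriv[OF Suc.prems], of "{-1<..<1}"])
       (use Suc in auto)
  then show ?case by (simp add: DERIV_imp_deriv)
qed

lemma degree_rodrigues_poly: "Polynomial.degree (rodrigues_poly a b j) \<le> j"
proof (induction j)
  case (Suc j)
  let ?q = "rodrigues_poly a b j"
  have 1: "Polynomial.degree ([:1, 1:] * ?q) \<le> Suc j" "Polynomial.degree ([:1, -1:] * ?q) \<le> Suc j"
    using Suc degree_mult_le[of "[:1, 1:]" ?q] degree_mult_le[of "[:1, -1:]" ?q] by simp_all
  have 2: "Polynomial.degree ([:1, 0, -1:] * pderiv ?q) \<le> Suc j"
  proof (cases "j = 0")
    case True
    then show ?thesis by (simp add: pderiv_1)
  next
    case False
    then show ?thesis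
      using Suc degree_mult_le[of "[:1, 0, -1:]" "pderiv ?q"] degree_pderiv[of ?q] by simp
  qed
  show ?case using 1 2
    by (auto intro!: degree_add_le order_trans[OF degree_smult_le] simp del: mult_pCons_left)
qed simp

text \<open>The three summands of the recursion multiply the leading coefficient by j - a, j - b and
  -j, in total by j - a - b.\<close>

lemma coeff_rodrigues_poly:
  "Polynomial.coeff (rodrigues_poly a b j) j = (\<Prod>i<j. real i - a - b)"
proof (induction j)
  case (Suc j)
  let ?q = "rodrigues_poly a b j"
  have 0: "Polynomial.coeff ?q (Suc j) = 0" "Polynomial.coeff ?q (Suc (Suc j)) = 0"
    using degree_rodrigues_poly[of a b j] by (auto intro!: Polynomial.coeff_eq_0)
  have "Polynomial.coeff ([:1, 0, -1:] * pderiv q) (Suc j) = - real j * Polynomial.coeff q j"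
    if "Polynomial.coeff q (Suc (Suc j)) = 0" for q :: "real poly"
    using that by (cases j) (auto simp: coeff_pderiv algebra_simps)
  from this[OF 0(2)] show ?case using 0 Suc by (simp add: algebra_simps del: mult_pCons_left)
                                 (simp add: algebra_simps)
qed simp

text \<open>This replaces the definite description in \<open>jacobi\<close> by a recursion from
  which degree and leading coefficient can be read off. Both polynomials agree on an open interval,
  hence everywhere.\<close>

lemma jacobi_eq_rodrigues_poly:
  "jacobi \<alpha> \<beta> k =
    Polynomial.smult ((-1) ^ k / (2 ^ k * fact k)) (rodrigues_poly (\<alpha> + real k) (\<beta> + real k) k)"
    (is "_ = ?q")
proof -
  let ?g = "\<lambda>y. jweight \<alpha> \<beta> y * (1 - y\<^sup>2) ^ k"
  have g: "?g y = jweight (\<alpha> + real k) (\<beta> + real k) y" if "y \<in> {-1<..<1}" for y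
  proof -
    have "1 - y\<^sup>2 = (1 - y) * (1 + y)" by (simp add: power2_eq_square algebra_simps)
    with that show ?thesis
      by (simp add: jweight_def powr_add powr_realpow power_mult_distrib)
  qed
  have "poly (jacobi \<alpha> \<beta> k - ?q) x = 0" if "x \<in> {-1<..<1}" for x
  proof -
    have "jweight \<alpha> \<beta> x \<noteq> 0" using that by (auto simp: jweight_def)
    then show ?thesis
      using that funpow_deriv_jweight[OF g, where j = k and x = x]
      by (simp add: poly_jacobi rodrigues_def)
  qed
  then have "{-1<..<1} \<subseteq> {x. poly (jacobi \<alpha> \<beta> k - ?q) x = 0}" by auto
  moreover have "infinite {-1<..<(1::real)}" by simp
  ultimately have "infinite {x. poly (jacobi \<alpha> \<beta> k - ?q) x = 0}" using finite_subset by blast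
  then have "jacobi \<alpha> \<beta> k - ?q = 0" using poly_roots_finite by blast
  then show ?thesis by simp
qed

lemma degree_jacobi_le: "Polynomial.degree (jacobi \<alpha> \<beta> k) \<le> k"
  unfolding jacobi_eq_rodrigues_poly
  by (rule order_trans[OF degree_smult_le degree_rodrigues_poly])

lemma coeff_jacobi:
  "Polynomial.coeff (jacobi \<alpha> \<beta> k) k = pochhammer (\<alpha> + \<beta> + real k + 1) k / (2 ^ k * fact k)"
proof -
  have "(\<Prod>i<k. real i - (\<alpha> + real k) - (\<beta> + real k)) = (\<Prod>i<k. - (\<alpha> + \<beta> + 2 * real k - real i))"
    by (intro prod.cong) auto
  also have "\<dots> = (-1) ^ k * (\<Prod>i<k. \<alpha> + \<beta> + 2 * real k - real i)"
    by (subst prod_uminus) simp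
  \<comment> \<open>Reversing the order of the factors, i to k - 1 - i, turns the falling product
    into a Pochhammer symbol.\<close>
  also have "(\<Prod>i<k. \<alpha> + \<beta> + 2 * real k - real i) = (\<Prod>i<k. \<alpha> + \<beta> + real k + 1 + real i)"
    by (subst prod.nat_diff_reindex[symmetric]) (auto intro!: prod.cong simp: of_nat_diff)
  finally have p: "(\<Prod>i<k. real i - (\<alpha> + real k) - (\<beta> + real k)) =
      (-1) ^ k * pochhammer (\<alpha> + \<beta> + real k + 1) k"
    by (simp only: pochhammer_prod lessThan_atLeast0)
  have "(-1) ^ k * (-1) ^ k = (1::real)" unfolding power_mult_distrib[symmetric] by simp
  then have "(-1) ^ k / (2 ^ k * fact k) * ((-1) ^ k * pochhammer (\<alpha> + \<beta> + real k + 1) k) =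
      pochhammer (\<alpha> + \<beta> + real k + 1) k / (2 ^ k * fact k)"
    by (simp only: mult.assoc[symmetric] times_divide_eq_left times_divide_eq_right mult_1_left)
  then show ?thesis
    by (simp only: jacobi_eq_rodrigues_poly Polynomial.coeff_smult coeff_rodrigues_poly p)
qed

text \<open>Integration by parts, j times; each step moves one derivative to g at the cost of a
  sign.\<close>

lemma rodrigues_poly_parts:
  assumes "a - real j > -1" "b - real j > -1"
  shows "((\<lambda>x. jweight (a - real j) (b - real j) x * poly (rodrigues_poly a b j) x * poly g x)
    has_integral (-1) ^ j * integral I (\<lambda>x. jweight a b x * poly ((pderiv ^^ j) g) x)) I"
  using assms
proof (induction j arbitrary: g)
  case 0
  then show ?case by (simp add: integrable_integral jweight_poly_integrable)
next
  case (Suc j)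
  define W where "W i x = jweight (a - real i) (b - real i) x * poly (rodrigues_poly a b i) x" for i x
  \<comment> \<open>At stage j the exponents are still positive, so \<open>W j\<close> is continuous
    up to the end points and vanishes there: no boundary terms appear, although the derivative
    \<open>W (Suc j)\<close> may be unbounded.\<close>
  have pos: "a - real j > 0" "b - real j > 0" using Suc.prems by auto
  have IH: "((\<lambda>x. W j x * poly (pderiv g) x) has_integral
     (-1) ^ j * integral I (\<lambda>x. jweight a b x * poly ((pderiv ^^ j) (pderiv g)) x)) I"
    unfolding W_def using pos by (intro Suc.IH) auto
  have "continuous_on I (W j)"
    unfolding W_def jweight_def using pos by (intro continuous_intros continuous_on_powr') auto
  moreover have "((\<lambda>x. W j x * poly g x) has_vector_derivative W (Suc j) x * poly g x + W j x * poly (pderiv g) x) (at x)"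
    if "x \<in> {-1<..<1}" for x
    using DERIV_mult[OF rodrigues_poly_deriv[OF that, of a j b] poly_DERIV[of g x]]
    unfolding has_real_derivative_iff_has_vector_derivative[symmetric] W_def
    by (simp add: algebra_simps)
  ultimately have "((\<lambda>x. W (Suc j) x * poly g x + W j x * poly (pderiv g) x)
    has_integral W j 1 * poly g 1 - W j (-1) * poly g (-1)) I"
    by (intro fundamental_theorem_of_calculus_interior[of "-1" 1 "\<lambda>x. W j x * poly g x"]
        continuous_intros) auto
  moreover have "W j 1 = 0" "W j (-1) = 0" using pos by (auto simp: W_def jweight_def)
  ultimately have "((\<lambda>x. W (Suc j) x * poly g x + W j x * poly (pderiv g) x) has_integral 0) I" by simp
  from has_integral_diff[OF this IH] show ?case
    unfolding W_def funpow_Suc_right o_def by simp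
qed

lemma funpow_pderiv_degree_le:
  fixes g :: "real poly"
  assumes "Polynomial.degree g \<le> k"
  shows "(pderiv ^^ k) g = [:fact k * Polynomial.coeff g k:]"
  using assms
proof (induction k arbitrary: g)
  case 0
  then show ?case by (metis degree_eq_zeroE le_zero_eq funpow_0 fact_0 mult_1 pCons_0_hom.hom_zero coeff_pCons_0)
next
  case (Suc k)
  have "Polynomial.degree (pderiv g) \<le> k" using Suc.prems degree_pderiv[of g] by simp
  from Suc.IH[OF this] show ?case
    by (simp add: funpow_Suc_right coeff_pderiv algebra_simps del: funpow.simps)
qed

section \<open>Orthonormality, Parseval's identity and expansion of polynomials\<close>

text \<open>After k integrations by parts only the k-th derivative of g is left, the constant k!
  times its coefficient. Orthogonality is the case of coefficient 0, the norm the case where g is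
  the Jacobi polynomial itself.\<close>

lemma jacobi_has_integral:
  assumes "\<alpha> > -1" "\<beta> > -1" "Polynomial.degree g \<le> k"
  shows "((\<lambda>x. jweight \<alpha> \<beta> x * poly (jacobi \<alpha> \<beta> k) x * poly g x) has_integral
    Polynomial.coeff g k / 2 ^ k * beta_const (\<alpha> + real k) (\<beta> + real k)) I"
proof -
  have "integral I (\<lambda>x. jweight (\<alpha> + real k) (\<beta> + real k) x * poly ((pderiv ^^ k) g) x) =
    beta_const (\<alpha> + real k) (\<beta> + real k) * (fact k * Polynomial.coeff g k)"
    using integral_unique[OF jweight_has_integral[of "\<alpha> + real k" "\<beta> + real k"]] assms(1,2)
    by (simp add: funpow_pderiv_degree_le[OF assms(3)])
  with rodrigues_poly_parts[of "\<alpha> + real k" k "\<beta> + real k" g] assms(1,2)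
  have "((\<lambda>x. jweight \<alpha> \<beta> x * poly (rodrigues_poly (\<alpha> + real k) (\<beta> + real k) k) x * poly g x) has_integral
    (-1) ^ k * (beta_const (\<alpha> + real k) (\<beta> + real k) * (fact k * Polynomial.coeff g k))) I"
    by simp
  from has_integral_mult_right[OF this, of "(-1) ^ k / (2 ^ k * fact k)"]
  show ?thesis by (simp add: jacobi_eq_rodrigues_poly algebra_simps power_mult_distrib[symmetric])
qed

text \<open>The right-hand side is the squared norm given by \<open>jacobi_has_integral\<close>, so
  \<open>jacobi_h\<close> normalizes correctly. For \<open>k = 0\<close> the Gamma quotient behind
  the Pochhammer symbol can have a pole, at \<alpha> + \<beta> = -1, hence the case
  distinction.\<close>

lemma jacobi_h_eq_beta_const:
  assumes "\<alpha> \<ge> -1/2" "\<beta> \<ge> -1/2"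
  shows "jacobi_h \<alpha> \<beta> k =
    Polynomial.coeff (jacobi \<alpha> \<beta> k) k / 2 ^ k * beta_const (\<alpha> + real k) (\<beta> + real k)"
proof (cases "k = 0")
  case True
  then show ?thesis by (simp add: coeff_jacobi jacobi_h_def beta_const_def Beta_def add_ac)
next
  case False
  define z where "z = \<alpha> + \<beta> + real k + 1"
  define y where "y = z + real k"
  have z: "z > 0" "y > 0" using assms False by (simp_all add: z_def y_def)
  have poch: "pochhammer z k = Gamma y / Gamma z"
    unfolding y_def using z by (intro pochhammer_Gamma) (auto elim!: nonpos_Ints_cases)
  define gz gy where "gz = Gamma z" and "gy = Gamma y"
  have Gz: "gz > 0" "gy > 0" unfolding gz_def gy_def using z by (auto intro!: Gamma_real_pos)
  have G: "Gamma (y + 1) = y * Gamma y"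
    using z by (intro Gamma_plus1) (auto elim!: nonpos_Ints_cases)
  have bc: "beta_const (\<alpha> + real k) (\<beta> + real k) =
    2 powr (\<alpha> + \<beta> + 1) * 2 ^ k * 2 ^ k * (Gamma (real k + \<alpha> + 1) * Gamma (real k + \<beta> + 1) / Gamma (y + 1))"
  proof -
    have "\<alpha> + real k + (\<beta> + real k) + 1 = (\<alpha> + \<beta> + 1) + real k + real k" by simp
    then have "2 powr (\<alpha> + real k + (\<beta> + real k) + 1) = 2 powr (\<alpha> + \<beta> + 1) * 2 ^ k * (2::real) ^ k"
      by (simp only: powr_add) (simp add: powr_realpow)
    then show ?thesis by (simp add: beta_const_def Beta_def y_def z_def add_ac)
  qed
  have "jacobi_h \<alpha> \<beta> k = 2 powr (\<alpha> + \<beta> + 1) * Gamma (real k + \<alpha> + 1) * Gamma (real k + \<beta> + 1) /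
        (fact k * y * Gamma z)"
    using False by (simp add: jacobi_h_def y_def z_def add_ac)
  also have "\<dots> = pochhammer z k / (2 ^ k * fact k) / 2 ^ k * beta_const (\<alpha> + real k) (\<beta> + real k)"
    unfolding bc G poch gz_def[symmetric] gy_def[symmetric] using Gz z by (simp add: field_simps)
  finally show ?thesis by (simp add: coeff_jacobi z_def)
qed

lemma coeff_jacobi_pos:
  assumes "\<alpha> \<ge> -1/2" "\<beta> \<ge> -1/2"
  shows "Polynomial.coeff (jacobi \<alpha> \<beta> k) k > 0"
proof (cases "k = 0")
  case False
  then have "pochhammer (\<alpha> + \<beta> + real k + 1) k > 0" using assms by (intro pochhammer_pos) simp
  then show ?thesis by (simp add: coeff_jacobi)
qed (simp add: coeff_jacobi)

lemma jacobi_h_pos: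
  assumes "\<alpha> \<ge> -1/2" "\<beta> \<ge> -1/2"
  shows "jacobi_h \<alpha> \<beta> k > 0"
  unfolding jacobi_h_eq_beta_const[OF assms] using assms
  by (intro mult_pos_pos divide_pos_pos coeff_jacobi_pos beta_const_pos) auto

lemma njacobi_0:
  assumes "\<alpha> \<ge> -1/2" "\<beta> \<ge> -1/2"
  shows "njacobi \<alpha> \<beta> 0 x = 1 / sqrt (beta_const \<alpha> \<beta>)"
proof -
  have "jacobi \<alpha> \<beta> 0 = 1" by (simp add: jacobi_eq_rodrigues_poly)
  then show ?thesis using jacobi_h_eq_beta_const[OF assms, of 0] by (simp add: njacobi_def)
qed

text \<open>By symmetry the smaller index may be the one of the test polynomial in
  \<open>jacobi_has_integral\<close>.\<close>

lemma njacobi_orthonormal: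
  assumes "\<alpha> \<ge> -1/2" "\<beta> \<ge> -1/2"
  shows "((\<lambda>x. njacobi \<alpha> \<beta> i x * njacobi \<alpha> \<beta> j x * jweight \<alpha> \<beta> x) has_integral (if i = j then 1 else 0)) I"
proof -
  have *: "((\<lambda>x. njacobi \<alpha> \<beta> i x * njacobi \<alpha> \<beta> j x * jweight \<alpha> \<beta> x) has_integral (if i = j then 1 else 0)) I"
    if "j \<le> i" for i j
  proof -
    have "Polynomial.degree (jacobi \<alpha> \<beta> j) \<le> i" using degree_jacobi_le[of \<alpha> \<beta> j] that by simp
    from jacobi_has_integral[OF _ _ this] assms
    have "((\<lambda>x. jweight \<alpha> \<beta> x * poly (jacobi \<alpha> \<beta> i) x * poly (jacobi \<alpha> \<beta> j) x) has_integral
      Polynomial.coeff (jacobi \<alpha> \<beta> j) i / 2 ^ i * beta_const (\<alpha> + real i) (\<beta> + real i)) I" by simp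
    from has_integral_mult_right[OF this, of "1 / (sqrt (jacobi_h \<alpha> \<beta> i) * sqrt (jacobi_h \<alpha> \<beta> j))"]
    have 1: "((\<lambda>x. njacobi \<alpha> \<beta> i x * njacobi \<alpha> \<beta> j x * jweight \<alpha> \<beta> x) has_integral
       Polynomial.coeff (jacobi \<alpha> \<beta> j) i / 2 ^ i * beta_const (\<alpha> + real i) (\<beta> + real i) /
         (sqrt (jacobi_h \<alpha> \<beta> i) * sqrt (jacobi_h \<alpha> \<beta> j))) I"
      by (simp add: njacobi_def mult_ac)
    show ?thesis
    proof (cases "i = j")
      case True
      then have "Polynomial.coeff (jacobi \<alpha> \<beta> j) i / 2 ^ i * beta_const (\<alpha> + real i) (\<beta> + real i) /
         (sqrt (jacobi_h \<alpha> \<beta> i) * sqrt (jacobi_h \<alpha> \<beta> j)) = 1"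
        unfolding True jacobi_h_eq_beta_const[OF assms, symmetric]
        using jacobi_h_pos[OF assms, of j] by simp
      from 1[unfolded this] True show ?thesis by simp
    next
      case False
      then have "Polynomial.coeff (jacobi \<alpha> \<beta> j) i = 0"
        using that degree_jacobi_le[of \<alpha> \<beta> j] by (intro Polynomial.coeff_eq_0) simp
      with 1 False show ?thesis by simp
    qed
  qed
  show ?thesis
  proof (cases "j \<le> i")
    case False
    then show ?thesis using *[of i j] by (simp add: mult.commute[of "njacobi \<alpha> \<beta> i _"] eq_commute)
  qed (rule *)
qed

lemma njacobi_parseval:
  assumes "\<alpha> \<ge> -1/2" "\<beta> \<ge> -1/2"
  shows "((\<lambda>x. (\<Sum>k\<le>N. d k * njacobi \<alpha> \<beta> k x)\<^sup>2 * jweight \<alpha> \<beta> x) has_integral (\<Sum>k\<le>N. (d k)\<^sup>2)) I"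
proof -
  have "((\<lambda>x. \<Sum>i\<le>N. \<Sum>j\<le>N. d i * d j * (njacobi \<alpha> \<beta> i x * njacobi \<alpha> \<beta> j x * jweight \<alpha> \<beta> x))
    has_integral (\<Sum>i\<le>N. \<Sum>j\<le>N. d i * d j * (if i = j then 1 else 0))) I"
    by (intro has_integral_sum has_integral_mult_right njacobi_orthonormal assms) auto
  moreover have "(\<Sum>i\<le>N. \<Sum>j\<le>N. d i * d j * (if i = j then 1 else 0)) = (\<Sum>k\<le>N. (d k)\<^sup>2)"
    by (simp add: power2_eq_square if_distrib cong: if_cong)
  moreover have "(\<lambda>x. \<Sum>i\<le>N. \<Sum>j\<le>N. d i * d j * (njacobi \<alpha> \<beta> i x * njacobi \<alpha> \<beta> j x * jweight \<alpha> \<beta> x)) =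
    (\<lambda>x. (\<Sum>k\<le>N. d k * njacobi \<alpha> \<beta> k x)\<^sup>2 * jweight \<alpha> \<beta> x)"
  proof
    fix x
    have "(\<Sum>k\<le>N. d k * njacobi \<alpha> \<beta> k x)\<^sup>2 * jweight \<alpha> \<beta> x =
      (\<Sum>i\<le>N. \<Sum>j\<le>N. (d i * njacobi \<alpha> \<beta> i x) * (d j * njacobi \<alpha> \<beta> j x)) * jweight \<alpha> \<beta> x"
      by (simp only: power2_eq_square sum_product)
    also have "\<dots> = (\<Sum>i\<le>N. \<Sum>j\<le>N. d i * d j * (njacobi \<alpha> \<beta> i x * njacobi \<alpha> \<beta> j x * jweight \<alpha> \<beta> x))"
      unfolding sum_distrib_right by (intro sum.cong refl) (simp only: mult_ac)
    finally show "(\<Sum>i\<le>N. \<Sum>j\<le>N. d i * d j * (njacobi \<alpha> \<beta> i x * njacobi \<alpha> \<beta> j x * jweight \<alpha> \<beta> x)) =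
      (\<Sum>k\<le>N. d k * njacobi \<alpha> \<beta> k x)\<^sup>2 * jweight \<alpha> \<beta> x" ..
  qed
  ultimately show ?thesis by simp
qed

text \<open>The leading coefficients are positive, so a multiple of the Jacobi polynomial of degree
  \<open>Suc N\<close> removes the top coefficient of P.\<close>

lemma njacobi_expansion:
  assumes "\<alpha> \<ge> -1/2" "\<beta> \<ge> -1/2" "Polynomial.degree P \<le> N"
  shows "\<exists>c. \<forall>x. poly P x = (\<Sum>k\<le>N. c k * njacobi \<alpha> \<beta> k x)"
  using assms(3)
proof (induction N arbitrary: P)
  case 0
  then obtain q where "P = [:q:]" using degree_eq_zeroE[of P] by auto
  then show ?case using njacobi_0[OF assms(1,2)] beta_const_pos[of \<alpha> \<beta>] assms(1,2)
    by (intro exI[of _ "\<lambda>_. q * sqrt (beta_const \<alpha> \<beta>)"]) simp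
next
  case (Suc N)
  let ?J = "jacobi \<alpha> \<beta> (Suc N)" and ?h = "jacobi_h \<alpha> \<beta> (Suc N)"
  define r where "r = Polynomial.coeff P (Suc N) / Polynomial.coeff ?J (Suc N)"
  have J: "Polynomial.coeff ?J (Suc N) > 0" and h: "?h > 0"
    using coeff_jacobi_pos[OF assms(1,2)] jacobi_h_pos[OF assms(1,2)] by blast+
  define Q where "Q = P - Polynomial.smult r ?J"
  have "Polynomial.coeff Q (Suc N) = 0" using J by (simp add: Q_def r_def)
  moreover have "Polynomial.degree Q \<le> Suc N"
    unfolding Q_def using Suc.prems degree_jacobi_le[of \<alpha> \<beta> "Suc N"]
    by (intro degree_diff_le order_trans[OF degree_smult_le])
  ultimately have "Polynomial.degree Q \<le> N"
    by (metis coeff_0 le_SucE leading_coeff_0_iff degree_0 le0)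
  from Suc.IH[OF this] obtain c where c: "\<And>x. poly Q x = (\<Sum>k\<le>N. c k * njacobi \<alpha> \<beta> k x)" by blast
  have "poly P x = (\<Sum>k\<le>Suc N. (c(Suc N := r * sqrt ?h)) k * njacobi \<alpha> \<beta> k x)" for x
  proof -
    have "poly P x = poly Q x + r * poly ?J x" by (simp add: Q_def)
    also have "r * poly ?J x = r * sqrt ?h * njacobi \<alpha> \<beta> (Suc N) x"
      using h by (simp add: njacobi_def)
    also have "poly Q x = (\<Sum>k\<le>N. (c(Suc N := r * sqrt ?h)) k * njacobi \<alpha> \<beta> k x)"
      unfolding c by (intro sum.cong) auto
    finally show ?thesis by simp
  qed
  then show ?case by blast
qed

section \<open>Extreme eigenvalues and stability of least squares\<close>

lemma scalar_prod_self_nonneg: "scalar_prod x x \<ge> (0 :: real)"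
  by (simp add: scalar_prod_def sum_nonneg)

lemma scalar_prod_self_eq_0:
  fixes x :: "real Matrix.vec"
  assumes "x \<in> carrier_vec n" "scalar_prod x x = 0"
  shows "x = 0\<^sub>v n"
proof (rule eq_vecI)
  fix i assume i: "i < dim_vec (0\<^sub>v n :: real Matrix.vec)"
  have "\<forall>i\<in>{0..<dim_vec x}. vec_index x i * vec_index x i = 0"
    using assms(2) unfolding scalar_prod_def by (subst (asm) sum_nonneg_eq_0_iff) auto
  then show "vec_index x i = vec_index (0\<^sub>v n) i" using i assms(1) by auto
qed (use assms in auto)

lemma mult_mat_vec_bounded:
  fixes A :: "real Matrix.mat"
  assumes A: "A \<in> carrier_mat m n"
  shows "\<exists>K>0. \<forall>x\<in>carrier_vec n. scalar_prod (A *\<^sub>v x) (A *\<^sub>v x) \<le> K * scalar_prod x x"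
proof -
  \<comment> \<open>The squared Frobenius norm; the added 1 keeps K positive for the zero
    matrix.\<close>
  define K where "K = (\<Sum>i<m. \<Sum>j<n. (A $$ (i, j))\<^sup>2) + 1"
  have "scalar_prod (A *\<^sub>v x) (A *\<^sub>v x) \<le> K * scalar_prod x x" if x: "x \<in> carrier_vec n" for x
  proof -
    have xx: "scalar_prod x x = (\<Sum>j<n. (vec_index x j)\<^sup>2)"
      using x by (simp add: scalar_prod_def power2_eq_square lessThan_atLeast0)
    have "scalar_prod (A *\<^sub>v x) (A *\<^sub>v x) = (\<Sum>i<m. (\<Sum>j<n. A $$ (i, j) * vec_index x j)\<^sup>2)"
      using A x by (simp add: scalar_prod_def power2_eq_square lessThan_atLeast0)
    also have "\<dots> \<le> (\<Sum>i<m. (\<Sum>j<n. (A $$ (i, j))\<^sup>2) * (\<Sum>j<n. (vec_index x j)\<^sup>2))"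
      by (intro sum_mono Cauchy_Schwarz_ineq_sum)
    also have "\<dots> = (\<Sum>i<m. \<Sum>j<n. (A $$ (i, j))\<^sup>2) * scalar_prod x x"
      by (simp only: xx sum_distrib_right)
    also have "\<dots> \<le> K * scalar_prod x x"
      by (intro mult_right_mono scalar_prod_self_nonneg) (simp add: K_def)
    finally show ?thesis .
  qed
  moreover have "K > 0" unfolding K_def by (intro add_nonneg_pos sum_nonneg) auto
  ultimately show ?thesis by blast
qed

lemma quadratic_form_bounded:
  fixes A :: "real Matrix.mat"
  assumes A: "A \<in> carrier_mat n n"
  shows "\<exists>K>0. \<forall>x\<in>carrier_vec n. \<bar>scalar_prod x (A *\<^sub>v x)\<bar> \<le> K * scalar_prod x x"
proof -
  obtain K where K: "K > 0" "\<And>x. x \<in> carrier_vec n \<Longrightarrow>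
      scalar_prod (A *\<^sub>v x) (A *\<^sub>v x) \<le> K * scalar_prod x x"
    using mult_mat_vec_bounded[OF A] by blast
  have "\<bar>scalar_prod x (A *\<^sub>v x)\<bar> \<le> (1 + K) * scalar_prod x x" if x: "x \<in> carrier_vec n" for x
  proof -
    let ?y = "A *\<^sub>v x"
    have y: "dim_vec ?y = n" using A by simp
    have ab: "\<bar>a * b\<bar> \<le> a * a + b * b" for a b :: real
    proof -
      have "2 * \<bar>a * b\<bar> \<le> a * a + b * b"
        using sum_squares_bound[of "\<bar>a\<bar>" "\<bar>b\<bar>"] by (simp add: abs_mult power2_eq_square)
      then show ?thesis by linarith
    qed
    have "\<bar>scalar_prod x ?y\<bar> \<le> (\<Sum>i\<in>{0..<n}. \<bar>vec_index x i * vec_index ?y i\<bar>)"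
      unfolding scalar_prod_def y by (rule sum_abs)
    also have "\<dots> \<le> (\<Sum>i\<in>{0..<n}. vec_index x i * vec_index x i + vec_index ?y i * vec_index ?y i)"
      by (intro sum_mono ab)
    also have "\<dots> = scalar_prod x x + scalar_prod ?y ?y"
      using x unfolding scalar_prod_def y by (simp add: sum.distrib)
    also have "\<dots> \<le> scalar_prod x x + K * scalar_prod x x" using K(2)[OF x] by simp
    finally show ?thesis by (simp add: algebra_simps)
  qed
  then show ?thesis using K(1) by (intro exI[of _ "1 + K"]) auto
qed

lemma symmetric_scalar_prod:
  fixes A :: "real Matrix.mat"
  assumes "A \<in> carrier_mat n n" "transpose_mat A = A" "x \<in> carrier_vec n" "y \<in> carrier_vec n"
  shows "scalar_prod x (A *\<^sub>v y) = scalar_prod y (A *\<^sub>v x)"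
  using transpose_vec_mult_scalar[OF assms(1,4,3)] assms(2) comm_scalar_prod[OF assms(4) mult_mat_vec_carrier[OF assms(1,3)]]
  by simp

text \<open>If \<open>\<bar>y \<bullet> A y\<bar> \<le> K (y \<bullet> y)\<close>, expand the form at \<open>x - (1/K) A x\<close>.\<close>
lemma psd_mult_mat_vec_bounded:
  fixes A :: "real Matrix.mat"
  assumes A: "A \<in> carrier_mat n n" and sym: "transpose_mat A = A"
    and psd: "\<And>x. x \<in> carrier_vec n \<Longrightarrow> scalar_prod x (A *\<^sub>v x) \<ge> 0"
  shows "\<exists>K>0. \<forall>x\<in>carrier_vec n. scalar_prod (A *\<^sub>v x) (A *\<^sub>v x) \<le> K * scalar_prod x (A *\<^sub>v x)"
proof -
  obtain K where K: "K > 0" "\<And>x. x \<in> carrier_vec n \<Longrightarrow> \<bar>scalar_prod x (A *\<^sub>v x)\<bar> \<le> K * scalar_prod x x"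
    using quadratic_form_bounded[OF A] by blast
  have "scalar_prod (A *\<^sub>v x) (A *\<^sub>v x) \<le> K * scalar_prod x (A *\<^sub>v x)" if x: "x \<in> carrier_vec n" for x
  proof -
    define y where "y = A *\<^sub>v x"
    have y: "y \<in> carrier_vec n" using A x by (simp add: y_def)
    define t where "t = - 1 / K"
    have Ay: "A *\<^sub>v y \<in> carrier_vec n" using A y by simp
    have Az: "A *\<^sub>v (x + t \<cdot>\<^sub>v y) = y + t \<cdot>\<^sub>v (A *\<^sub>v y)"
      using A x y by (simp add: mult_add_distrib_mat_vec mult_mat_vec y_def)
    have "0 \<le> scalar_prod (x + t \<cdot>\<^sub>v y) (A *\<^sub>v (x + t \<cdot>\<^sub>v y))"
      using x y by (intro psd) simp
    also have "\<dots> = scalar_prod x y + t * scalar_prod x (A *\<^sub>v y) + t * scalar_prod y y + t * (t * scalar_prod y (A *\<^sub>v y))"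
      unfolding Az using x y Ay
      by (simp add: add_scalar_prod_distrib[of _ n] scalar_prod_add_distrib[of _ n] algebra_simps)
    also have "scalar_prod x (A *\<^sub>v y) = scalar_prod y y"
      using symmetric_scalar_prod[OF A sym x y] by (simp add: y_def)
    finally have "0 \<le> scalar_prod x y + 2 * t * scalar_prod y y + t * t * scalar_prod y (A *\<^sub>v y)"
      by (simp add: algebra_simps)
    also have "\<dots> \<le> scalar_prod x y + 2 * t * scalar_prod y y + t * t * (K * scalar_prod y y)"
      using K(2)[OF y] by (intro add_left_mono mult_left_mono) auto
    also have "\<dots> = scalar_prod x y - scalar_prod y y / K" using K(1) by (simp add: t_def field_simps)
    finally show ?thesis using K(1) by (simp add: y_def[symmetric] field_simps)
  qed
  with K(1) show ?thesis by blast
qed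

text \<open>Without compactness: let \<open>l\<close> be the infimum of the Rayleigh quotients. If \<open>A - l\<close> were
  invertible, this positive semidefinite matrix would be bounded below, so \<open>l\<close> could be increased.\<close>
lemma symmetric_min_eigenvalue:
  fixes A :: "real Matrix.mat"
  assumes A: "A \<in> carrier_mat n n" and sym: "transpose_mat A = A" and n: "n > 0"
  obtains l where "eigenvalue A l"
    "\<And>x. x \<in> carrier_vec n \<Longrightarrow> l * scalar_prod x x \<le> scalar_prod x (A *\<^sub>v x)"
proof -
  define R where "R = {scalar_prod x (A *\<^sub>v x) | x. x \<in> carrier_vec n \<and> scalar_prod x x = 1}"
  define l where "l = Inf R"
  obtain K where K: "\<And>x. x \<in> carrier_vec n \<Longrightarrow> \<bar>scalar_prod x (A *\<^sub>v x)\<bar> \<le> K * scalar_prod x x"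
    using quadratic_form_bounded[OF A] by blast
  have "-K \<le> r" if "r \<in> R" for r
  proof -
    obtain x where "x \<in> carrier_vec n" "scalar_prod x x = 1" "r = scalar_prod x (A *\<^sub>v x)"
      using \<open>r \<in> R\<close> by (auto simp: R_def)
    with K[of x] show ?thesis by simp
  qed
  then have bdd: "bdd_below R" by (intro bdd_belowI[of _ "-K"])
  have "scalar_prod (unit_vec n 0) (A *\<^sub>v unit_vec n 0) \<in> R"
    using n by (auto simp: R_def intro!: exI[of _ "unit_vec n 0"])
  then have ne: "R \<noteq> {}" by blast
  have l: "l * scalar_prod x x \<le> scalar_prod x (A *\<^sub>v x)" if x: "x \<in> carrier_vec n" for x
  proof (cases "scalar_prod x x = 0")
    case True
    then have "x = 0\<^sub>v n" using x scalar_prod_self_eq_0 by blast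
    then show ?thesis using True A by simp
  next
    case False
    define s where "s = scalar_prod x x"
    have s: "s > 0" using False scalar_prod_self_nonneg[of x] by (simp add: s_def)
    define y where "y = (1 / sqrt s) \<cdot>\<^sub>v x"
    have y: "y \<in> carrier_vec n" using x by (simp add: y_def)
    have "scalar_prod y y = 1" using x s by (simp add: y_def s_def[symmetric] real_sqrt_mult_self field_simps)
    then have "scalar_prod y (A *\<^sub>v y) \<in> R" using y by (auto simp: R_def)
    then have "l \<le> scalar_prod y (A *\<^sub>v y)" unfolding l_def using bdd by (rule cInf_lower)
    also have "\<dots> = scalar_prod x (A *\<^sub>v x) / s"
      using A x s by (simp add: y_def mult_mat_vec real_sqrt_mult_self field_simps)
    finally show ?thesis using s by (simp add: s_def[symmetric] field_simps)
  qed
  have "eigenvalue A l"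
  proof (rule ccontr)
    assume "\<not> eigenvalue A l"
    define M where "M = char_matrix A l"
    have M: "M \<in> carrier_mat n n" using A by (simp add: M_def)
    have Mv: "M *\<^sub>v x = A *\<^sub>v x + (-l) \<cdot>\<^sub>v x" if "x \<in> carrier_vec n" for x
    proof -
      have "M *\<^sub>v x = A *\<^sub>v x + ((-l) \<cdot>\<^sub>m 1\<^sub>m n) *\<^sub>v x"
        using A that unfolding M_def char_matrix_def by (subst add_mult_distrib_mat_vec) auto
      also have "((-l) \<cdot>\<^sub>m 1\<^sub>m n) *\<^sub>v x = (-l) \<cdot>\<^sub>v x"
        using that by (intro eq_vecI) auto
      finally show ?thesis .
    qed
    have q: "scalar_prod x (M *\<^sub>v x) = scalar_prod x (A *\<^sub>v x) - l * scalar_prod x x"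
      if "x \<in> carrier_vec n" for x
      using that A by (simp add: Mv scalar_prod_add_distrib[of _ n])
    have "transpose_mat M = M"
    proof (rule eq_matI)
      fix i j assume ij: "i < dim_row M" "j < dim_col M"
      have "A $$ (j, i) = A $$ (i, j)"
        using A ij M sym by (metis carrier_matD index_transpose_mat(1))
      then show "transpose_mat M $$ (i, j) = M $$ (i, j)"
        using A ij M unfolding M_def char_matrix_def by auto
    qed (use M in auto)
    from psd_mult_mat_vec_bounded[OF M this] obtain K2 where K2: "K2 > 0"
      "\<And>x. x \<in> carrier_vec n \<Longrightarrow> scalar_prod (M *\<^sub>v x) (M *\<^sub>v x) \<le> K2 * scalar_prod x (M *\<^sub>v x)"
      using q l by fastforce
    have "det M \<noteq> 0" using \<open>\<not> eigenvalue A l\<close> eigenvalue_det[OF A] by (simp add: M_def)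
    from det_non_zero_imp_unit[OF M this, of "()"] obtain N where
      N: "N \<in> carrier_mat n n" "N * M = 1\<^sub>m n"
      unfolding Units_def ring_mat_def by auto
    obtain K1 where K1: "K1 > 0"
      "\<And>x. x \<in> carrier_vec n \<Longrightarrow> scalar_prod (N *\<^sub>v x) (N *\<^sub>v x) \<le> K1 * scalar_prod x x"
      using mult_mat_vec_bounded[OF N(1)] by blast
    \<comment> \<open>For a unit vector x, applying the inverse \<open>N\<close> to M x gives 1
      \<le> K1 |M x|^2 \<le> K1 K2 (r - l), a gap independent of x.\<close>
    have "l + 1 / (K1 * K2) \<le> r" if "r \<in> R" for r
    proof -
      obtain x where x: "x \<in> carrier_vec n" "scalar_prod x x = 1" "r = scalar_prod x (A *\<^sub>v x)"
        using \<open>r \<in> R\<close> by (auto simp: R_def)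
      have Mx: "M *\<^sub>v x \<in> carrier_vec n" using M x by simp
      have "N *\<^sub>v (M *\<^sub>v x) = x" using assoc_mult_mat_vec[OF N(1) M x(1)] N(2) x(1) by simp
      then have "1 \<le> K1 * scalar_prod (M *\<^sub>v x) (M *\<^sub>v x)" using K1(2)[OF Mx] x(2) by simp
      also have "\<dots> \<le> K1 * (K2 * scalar_prod x (M *\<^sub>v x))"
        using K1(1) K2(2)[OF x(1)] by (intro mult_left_mono) auto
      also have "scalar_prod x (M *\<^sub>v x) = r - l" using q[OF x(1)] x by simp
      finally show ?thesis using K1(1) K2(1) by (simp add: field_simps)
    qed
    then have "l + 1 / (K1 * K2) \<le> l" unfolding l_def using ne by (intro cInf_greatest)
    moreover have "1 / (K1 * K2) > 0" using K1(1) K2(1) by simp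
    ultimately show False by simp
  qed
  with l that show ?thesis by blast
qed

lemma Min_spectrum_le:
  fixes A :: "real Matrix.mat"
  assumes "A \<in> carrier_mat n n" "transpose_mat A = A" "n > 0" "x \<in> carrier_vec n"
  shows "Min (spectrum A) * scalar_prod x x \<le> scalar_prod x (A *\<^sub>v x)"
proof -
  obtain l where l: "eigenvalue A l"
    "l * scalar_prod x x \<le> scalar_prod x (A *\<^sub>v x)"
    using symmetric_min_eigenvalue[OF assms(1-3)] assms(4) by metis
  have "Min (spectrum A) \<le> l"
    using l(1) card_finite_spectrum(1)[OF assms(1)] by (intro Min_le) (auto simp: spectrum_def)
  then have "Min (spectrum A) * scalar_prod x x \<le> l * scalar_prod x x"
    by (intro mult_right_mono scalar_prod_self_nonneg)
  with l(2) show ?thesis by simp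
qed

text \<open>The minimum result for \<open>- A\<close>, whose eigenvalues are the negatives of those
  of A.\<close>

lemma Max_spectrum_ge:
  fixes A :: "real Matrix.mat"
  assumes A: "A \<in> carrier_mat n n" and sym: "transpose_mat A = A" and n: "n > 0"
    and x: "x \<in> carrier_vec n"
  shows "scalar_prod x (A *\<^sub>v x) \<le> Max (spectrum A) * scalar_prod x x"
proof -
  have neg: "(- A) *\<^sub>v v = - (A *\<^sub>v v)" if "v \<in> carrier_vec n" for v
    using A that by (intro eq_vecI) auto
  have A': "- A \<in> carrier_mat n n" "transpose_mat (- A) = - A"
    using A sym by (auto simp: transpose_uminus)
  obtain l where l: "eigenvalue (- A) l" "l * scalar_prod x x \<le> scalar_prod x ((- A) *\<^sub>v x)"
    using symmetric_min_eigenvalue[OF A' n] x by metis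
  then obtain v where v: "v \<in> carrier_vec n" "v \<noteq> 0\<^sub>v n" "(- A) *\<^sub>v v = l \<cdot>\<^sub>v v"
    using A by (auto simp: eigenvalue_def eigenvector_def)
  have "A *\<^sub>v v = - (- (A *\<^sub>v v))" by simp
  also have "\<dots> = - (l \<cdot>\<^sub>v v)" using v neg by simp
  also have "\<dots> = (- l) \<cdot>\<^sub>v v" by (intro eq_vecI) auto
  finally have "eigenvalue A (- l)" using A v by (auto simp: eigenvalue_def eigenvector_def)
  then have "- l \<le> Max (spectrum A)"
    using card_finite_spectrum(1)[OF A] by (intro Max_ge) (auto simp: spectrum_def)
  then have "- l * scalar_prod x x \<le> Max (spectrum A) * scalar_prod x x"
    by (intro mult_right_mono scalar_prod_self_nonneg)
  moreover have "scalar_prod x ((- A) *\<^sub>v x) = - scalar_prod x (A *\<^sub>v x)"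
    unfolding neg[OF x] using A x by (intro scalar_prod_uminus_right) auto
  ultimately show ?thesis using l(2) by simp
qed

text \<open>Makes \<open>the (mat_inverse A)\<close> in the estimator a genuine two-sided inverse.
  The dimensions of the inverse are read off from the two products.\<close>

lemma invertible_mat_inverse:
  fixes A :: "'a :: field Matrix.mat"
  assumes A: "A \<in> carrier_mat n n" and inv: "invertible_mat A"
  shows "\<exists>C. mat_inverse A = Some C \<and> C \<in> carrier_mat n n \<and> A * C = 1\<^sub>m n \<and> C * A = 1\<^sub>m n"
proof -
  obtain B where B: "A * B = 1\<^sub>m n" "B * A = 1\<^sub>m (dim_row B)"
    using inv A unfolding invertible_mat_def inverts_mat_def by auto
  have "dim_col B = n" using arg_cong[OF B(1), of dim_col] by simp
  moreover have "dim_row B = n" using arg_cong[OF B(2), of dim_col] A by simp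
  ultimately have "B \<in> carrier_mat n n" by auto
  then have "A \<in> Units (ring_mat TYPE('a) n ())"
    using A B unfolding Units_def ring_mat_def by auto
  then obtain C where "mat_inverse A = Some C" using mat_inverse(1)[OF A, where b = "()"] by (cases "mat_inverse A") auto
  then show ?thesis using mat_inverse(2)[OF A] by auto
qed

section \<open>Gram matrices and the stability of least squares\<close>

context
  fixes B A :: "real Matrix.mat" and n m :: nat
  assumes B: "B \<in> carrier_mat n m" and A_def: "A = transpose_mat B * B"
begin

lemma gram_carrier: "A \<in> carrier_mat m m"
  using B by (simp add: A_def)

lemma gram_symmetric: "transpose_mat A = A"
  using B by (simp add: A_def transpose_mult[of _ m n])

lemma gram_form:
  assumes "x \<in> carrier_vec m"
  shows "scalar_prod x (A *\<^sub>v x) = scalar_prod (B *\<^sub>v x) (B *\<^sub>v x)"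
proof -
  have Bx: "B *\<^sub>v x \<in> carrier_vec n" using B assms by simp
  have "A *\<^sub>v x = transpose_mat B *\<^sub>v (B *\<^sub>v x)"
    unfolding A_def using B assms by (intro assoc_mult_mat_vec) auto
  then have "scalar_prod x (A *\<^sub>v x) = scalar_prod (transpose_mat B *\<^sub>v (B *\<^sub>v x)) x"
    using B assms Bx by (simp add: comm_scalar_prod[of _ m])
  also have "\<dots> = scalar_prod (B *\<^sub>v x) (B *\<^sub>v x)"
    using transpose_vec_mult_scalar[OF B assms Bx] .
  finally show ?thesis .
qed

text \<open>An eigenvector v satisfies l |v|^2 = |B v|^2 \<ge> 0, and invertibility excludes l =
  0.\<close>

lemma gram_spectrum_pos:
  assumes "invertible_mat A" "l \<in> spectrum A"
  shows "l > 0"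
proof -
  obtain v where v: "v \<in> carrier_vec m" "v \<noteq> 0\<^sub>v m" "A *\<^sub>v v = l \<cdot>\<^sub>v v"
    using assms(2) gram_carrier by (auto simp: spectrum_def eigenvalue_def eigenvector_def)
  obtain C where C: "C \<in> carrier_mat m m" "C * A = 1\<^sub>m m"
    using invertible_mat_inverse[OF gram_carrier assms(1)] by blast
  have "l \<noteq> 0"
  proof
    assume "l = 0"
    then have "A *\<^sub>v v = 0\<^sub>v m" using v by auto
    moreover have "v = C *\<^sub>v (A *\<^sub>v v)"
      using assoc_mult_mat_vec[OF C(1) gram_carrier v(1)] C(2) v(1) by simp
    ultimately have "v = 0\<^sub>v m" using C(1) by auto
    with v(2) show False ..
  qed
  moreover have "l * scalar_prod v v \<ge> 0"
    using gram_form[OF v(1)] v scalar_prod_self_nonneg[of "B *\<^sub>v v"] by simp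
  moreover have "scalar_prod v v > 0"
    using scalar_prod_self_eq_0[OF v(1)] v(2) scalar_prod_self_nonneg[of v] by fastforce
  ultimately show ?thesis by (simp add: zero_le_mult_iff)
qed

text \<open>\<open>Min\<close> is meaningful only for a nonempty spectrum; a real eigenvalue is
  supplied by \<open>symmetric_min_eigenvalue\<close>.\<close>

lemma gram_Min_spectrum_pos:
  assumes "invertible_mat A" "m > 0"
  shows "Min (spectrum A) > 0"
proof -
  obtain l where "eigenvalue A l"
    using symmetric_min_eigenvalue[OF gram_carrier gram_symmetric assms(2)] by metis
  then have "spectrum A \<noteq> {}" by (auto simp: spectrum_def)
  then have "Min (spectrum A) \<in> spectrum A" using card_finite_spectrum(1)[OF gram_carrier] by (intro Min_in)
  then show ?thesis using gram_spectrum_pos[OF assms(1)] by blast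
qed

text \<open>Here c is any comparison vector and w its residual. By the normal equations w - B d is
  orthogonal to the range of B, so B d is the orthogonal projection of w and no longer than
  w.\<close>

lemma least_squares_stable:
  assumes inv: "invertible_mat A" and m: "m > 0" and y: "y \<in> carrier_vec n" and c: "c \<in> carrier_vec m"
  defines "d \<equiv> (the (mat_inverse A) * transpose_mat B) *\<^sub>v y - c"
    and "w \<equiv> y - B *\<^sub>v c"
  shows "Min (spectrum A) * scalar_prod d d \<le> scalar_prod w w"
proof -
  note A = gram_carrier
  obtain C where C: "mat_inverse A = Some C" "C \<in> carrier_mat m m" "A * C = 1\<^sub>m m"
    using invertible_mat_inverse[OF A inv] by blast
  have Bt: "transpose_mat B \<in> carrier_mat m n" using B by simp
  have Bc: "B *\<^sub>v c \<in> carrier_vec n" and w: "w \<in> carrier_vec n"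
    using B c y by (simp_all add: w_def)
  have Bty: "transpose_mat B *\<^sub>v y \<in> carrier_vec m" using Bt y by simp
  have ls: "(the (mat_inverse A) * transpose_mat B) *\<^sub>v y = C *\<^sub>v (transpose_mat B *\<^sub>v y)"
    using C(1,2) Bt y by simp
  have d: "d \<in> carrier_vec m" unfolding d_def ls using C(2) Bty c by simp
  have Bd: "B *\<^sub>v d \<in> carrier_vec n" using B d by simp
  have "A *\<^sub>v d = A *\<^sub>v (C *\<^sub>v (transpose_mat B *\<^sub>v y)) - A *\<^sub>v c"
    unfolding d_def ls using A C(2) Bty c by (intro mult_minus_distrib_mat_vec) auto
  also have "A *\<^sub>v (C *\<^sub>v (transpose_mat B *\<^sub>v y)) = transpose_mat B *\<^sub>v y"
    using assoc_mult_mat_vec[OF A C(2) Bty] C(3) Bty by simp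
  also have "A *\<^sub>v c = transpose_mat B *\<^sub>v (B *\<^sub>v c)"
    unfolding A_def using B c by (intro assoc_mult_mat_vec) auto
  also have "transpose_mat B *\<^sub>v y - transpose_mat B *\<^sub>v (B *\<^sub>v c) = transpose_mat B *\<^sub>v w"
    unfolding w_def using mult_minus_distrib_mat_vec[OF Bt y Bc] by simp
  finally have Ad: "A *\<^sub>v d = transpose_mat B *\<^sub>v w" .
  have "scalar_prod (B *\<^sub>v d) (B *\<^sub>v d) = scalar_prod d (A *\<^sub>v d)" using gram_form[OF d] by simp
  also have "\<dots> = scalar_prod (transpose_mat B *\<^sub>v w) d"
    unfolding Ad using Bt w d by (intro comm_scalar_prod[of _ m]) auto
  also have "\<dots> = scalar_prod w (B *\<^sub>v d)" by (rule transpose_vec_mult_scalar[OF B d w])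
  finally have eq: "scalar_prod (B *\<^sub>v d) (B *\<^sub>v d) = scalar_prod w (B *\<^sub>v d)" .
  have "0 \<le> scalar_prod (w - B *\<^sub>v d) (w - B *\<^sub>v d)" by (rule scalar_prod_self_nonneg)
  also have "\<dots> = scalar_prod w w - scalar_prod w (B *\<^sub>v d) - (scalar_prod (B *\<^sub>v d) w - scalar_prod (B *\<^sub>v d) (B *\<^sub>v d))"
    using w Bd by (simp add: minus_scalar_prod_distrib[of _ n] scalar_prod_minus_distrib[of _ n])
  also have "scalar_prod (B *\<^sub>v d) w = scalar_prod w (B *\<^sub>v d)" by (rule comm_scalar_prod[OF Bd w])
  finally have "scalar_prod (B *\<^sub>v d) (B *\<^sub>v d) \<le> scalar_prod w w" using eq by simp
  moreover have "Min (spectrum A) * scalar_prod d d \<le> scalar_prod d (A *\<^sub>v d)"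
    by (rule Min_spectrum_le[OF A gram_symmetric m d])
  ultimately show ?thesis using gram_form[OF d] by simp
qed

end

section \<open>The risk bound\<close>

lemma continuous_on_njacobi: "continuous_on A (njacobi a b k)"
  unfolding njacobi_def divide_inverse by (intro continuous_intros)

text \<open>Meant for F = f - fhat and the sum fhat - P, so that F plus the sum is the approximation
  error f - P.\<close>

lemma wnorm_le_njacobi_sum:
  assumes "\<alpha> \<ge> -1/2" "\<beta> \<ge> -1/2"
    and F: "\<And>x. x \<in> I \<Longrightarrow> \<bar>F x + (\<Sum>k\<le>N. d k * njacobi \<alpha> \<beta> k x)\<bar> \<le> r"
  shows "wnorm \<alpha> \<beta> F \<le> sqrt (2 * beta_const \<alpha> \<beta> * r\<^sup>2 + 2 * (\<Sum>k\<le>N. (d k)\<^sup>2))"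
proof -
  have ab: "\<alpha> > -1" "\<beta> > -1" using assms by auto
  define S where "S x = (\<Sum>k\<le>N. d k * njacobi \<alpha> \<beta> k x)" for x
  define G where "G x = (2 * r\<^sup>2 + 2 * (S x)\<^sup>2) * jweight \<alpha> \<beta> x" for x
  have int: "set_integrable lborel I G"
    unfolding G_def S_def using ab
    by (intro continuous_jweight_set_integrable continuous_intros continuous_on_njacobi)
  have "((\<lambda>x. 2 * r\<^sup>2 * jweight \<alpha> \<beta> x + 2 * ((S x)\<^sup>2 * jweight \<alpha> \<beta> x)) has_integral
    2 * r\<^sup>2 * beta_const \<alpha> \<beta> + 2 * (\<Sum>k\<le>N. (d k)\<^sup>2)) I"
    unfolding S_def
    by (intro has_integral_add has_integral_mult_right jweight_has_integral njacobi_parseval assms ab)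
  moreover have "(\<lambda>x. 2 * r\<^sup>2 * jweight \<alpha> \<beta> x + 2 * ((S x)\<^sup>2 * jweight \<alpha> \<beta> x)) = G"
    by (simp add: fun_eq_iff G_def algebra_simps)
  ultimately have G: "(LINT x:I|lborel. G x) = 2 * beta_const \<alpha> \<beta> * r\<^sup>2 + 2 * (\<Sum>k\<le>N. (d k)\<^sup>2)"
    using set_borel_integral_eq_integral(2)[OF int] by (simp add: integral_unique mult_ac)
  have FG: "\<bar>F x\<bar>\<^sup>2 * jweight \<alpha> \<beta> x \<le> G x" if "x \<in> I" for x
  proof -
    have "F x = (F x + S x) + (- S x)" by simp
    \<comment> \<open>The right side minus the left side is (F + 2 S)^2.\<close>
    then have "(F x)\<^sup>2 \<le> 2 * (F x + S x)\<^sup>2 + 2 * (S x)\<^sup>2"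
      using sum_squares_ge_zero[of "F x + 2 * S x" 0] by (simp add: power2_eq_square algebra_simps)
    moreover have "(F x + S x)\<^sup>2 \<le> r\<^sup>2"
      using F[OF that] unfolding S_def[symmetric] by (rule power2_le_iff_abs_le[THEN iffD2, rotated])
         (use F[OF that] in simp)
    ultimately have "(F x)\<^sup>2 \<le> 2 * r\<^sup>2 + 2 * (S x)\<^sup>2" by linarith
    then show ?thesis unfolding G_def by (simp add: mult_right_mono jweight_nonneg)
  qed
  \<comment> \<open>It is enough that the majorant \<open>G\<close> is integrable and nonnegative:
    the integral of a non-integrable function is 0 by convention.\<close>
  have "(LINT x:I|lborel. \<bar>F x\<bar>\<^sup>2 * jweight \<alpha> \<beta> x) \<le> (LINT x:I|lborel. G x)"
    using int unfolding set_lebesgue_integral_def set_integrable_def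
  proof (rule integral_mono')
    fix x
    show "indicator I x *\<^sub>R (\<bar>F x\<bar>\<^sup>2 * jweight \<alpha> \<beta> x) \<le> indicator I x *\<^sub>R G x"
      using FG[of x] by (cases "x \<in> I") auto
    show "0 \<le> indicator I x *\<^sub>R G x" by (simp add: G_def jweight_nonneg)
  qed
  then show ?thesis unfolding wnorm_def G by (rule real_sqrt_le_mono)
qed

lemma lsq_estimator_eq:
  "lsq_estimator \<alpha> \<beta> n N X Y x = (\<Sum>k\<le>N. vec_index (lsq_coeffs \<alpha> \<beta> n N X Y) k * njacobi \<alpha> \<beta> k x)"
  unfolding lsq_estimator_def by (simp add: sum.atLeast1_atMost_eq flip: lessThan_Suc_atMost)

lemma B_mat_carrier: "B_mat \<alpha> \<beta> n N X \<in> carrier_mat n (N + 1)"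
  by (simp add: B_mat_def)

lemma B_mat_mult_vec:
  assumes "j < n"
  shows "vec_index (B_mat \<alpha> \<beta> n N X *\<^sub>v Matrix.vec (N + 1) c) j =
    1 / sqrt (real n) * (\<Sum>k\<le>N. c k * njacobi \<alpha> \<beta> k (X (j + 1)))"
  using assms by (simp add: B_mat_def scalar_prod_def sum_distrib_left lessThan_Suc_atMost
      lessThan_atLeast0[symmetric] mult_ac del: sum.lessThan_Suc sum.op_ivl_Suc)

text \<open>The scaling by 1 / sqrt n turns a uniform bound on n residuals into the same bound on
  the Euclidean norm.\<close>

lemma scalar_prod_self_le:
  fixes w :: "real Matrix.vec"
  assumes "dim_vec w = n" "\<And>j. j < n \<Longrightarrow> \<bar>sqrt (real n) * vec_index w j\<bar> \<le> r" "r \<ge> 0"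
  shows "scalar_prod w w \<le> r\<^sup>2"
proof (cases "n = 0")
  case True
  then show ?thesis using assms by (simp add: scalar_prod_def)
next
  case False
  have "vec_index w j * vec_index w j \<le> r\<^sup>2 / real n" if "j < n" for j
  proof -
    have "(sqrt (real n) * vec_index w j)\<^sup>2 \<le> r\<^sup>2"
      using assms(2)[OF that] assms(3) by (simp add: abs_le_square_iff[symmetric])
    moreover have "(sqrt (real n) * vec_index w j)\<^sup>2 = real n * (vec_index w j * vec_index w j)"
      unfolding power_mult_distrib by (simp add: power2_eq_square)
    ultimately have "real n * (vec_index w j * vec_index w j) \<le> r\<^sup>2" by simp
    then show ?thesis using False by (simp add: field_simps)
  qed
  then have "scalar_prod w w \<le> (\<Sum>j\<in>{0..<n}. r\<^sup>2 / real n)"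
    unfolding scalar_prod_def assms(1) by (intro sum_mono) auto
  then show ?thesis using False by simp
qed

text \<open>The Rayleigh quotient at the first unit vector. The first column of \<open>B_mat\<close>
  is constant, so the bound is the same for all design points.\<close>

lemma Max_spectrum_A_mat_ge:
  assumes "\<alpha> \<ge> -1/2" "\<beta> \<ge> -1/2" "n > 0"
  shows "1 / beta_const \<alpha> \<beta> \<le> Max (spectrum (A_mat \<alpha> \<beta> n N X))"
proof -
  let ?B = "B_mat \<alpha> \<beta> n N X" and ?A = "A_mat \<alpha> \<beta> n N X"
  note gram = gram_carrier[OF B_mat_carrier A_mat_def] gram_symmetric[OF B_mat_carrier A_mat_def]
  let ?e = "Matrix.vec (N + 1) (\<lambda>k. if k = 0 then 1 else 0 :: real)"
  have e: "?e \<in> carrier_vec (N + 1)" by simp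
  have "vec_index (?B *\<^sub>v ?e) j = 1 / sqrt (real n) * (1 / sqrt (beta_const \<alpha> \<beta>))" if "j < n" for j
  proof -
    have "(\<Sum>k\<le>N. (if k = 0 then 1 else 0) * njacobi \<alpha> \<beta> k (X (j + 1))) =
      (\<Sum>k\<le>N. if k = 0 then njacobi \<alpha> \<beta> k (X (j + 1)) else 0)"
      by (intro sum.cong) auto
    then show ?thesis
      unfolding B_mat_mult_vec[OF that] by (simp add: njacobi_0[OF assms(1,2)])
  qed
  then have "scalar_prod (?B *\<^sub>v ?e) (?B *\<^sub>v ?e) =
    (\<Sum>j\<in>{0..<n}. 1 / sqrt (real n) * (1 / sqrt (beta_const \<alpha> \<beta>)) * (1 / sqrt (real n) * (1 / sqrt (beta_const \<alpha> \<beta>))))"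
    unfolding scalar_prod_def by (intro sum.cong) (auto simp: B_mat_def)
  also have "\<dots> = 1 / beta_const \<alpha> \<beta>"
    using assms(3) beta_const_pos[of \<alpha> \<beta>] assms(1,2) by (simp add: field_simps)
  finally have "scalar_prod ?e (?A *\<^sub>v ?e) = 1 / beta_const \<alpha> \<beta>"
    using gram_form[OF B_mat_carrier A_mat_def e] by simp
  moreover have "scalar_prod ?e ?e = 1"
  proof -
    have "scalar_prod ?e ?e = (\<Sum>k\<in>{0..<N + 1}. if k = 0 then 1 else 0)"
      unfolding scalar_prod_def dim_vec by (intro sum.cong) auto
    then show ?thesis by simp
  qed
  moreover have "scalar_prod ?e (?A *\<^sub>v ?e) \<le> Max (spectrum ?A) * scalar_prod ?e ?e"
    by (rule Max_spectrum_ge[OF gram _ e]) simp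
  ultimately show ?thesis by simp
qed

lemma lsq_estimator_error:
  assumes ab: "\<alpha> \<ge> -1/2" "\<beta> \<ge> -1/2" and n: "n > 0"
    and X: "\<And>i. i \<in> {1..n} \<Longrightarrow> X i \<in> I"
    and P: "Polynomial.degree P \<le> N" "\<And>x. x \<in> I \<Longrightarrow> \<bar>f x - poly P x\<bar> \<le> r"
    and e: "\<And>i. i \<in> {1..n} \<Longrightarrow> \<bar>\<epsilon> i\<bar> \<le> e"
    and inv: "invertible_mat (A_mat \<alpha> \<beta> n N X)"
  defines "\<kappa> \<equiv> Max (spectrum (A_mat \<alpha> \<beta> n N X)) / Min (spectrum (A_mat \<alpha> \<beta> n N X))"
  shows "\<kappa> \<ge> 0"
    and "wnorm \<alpha> \<beta> (\<lambda>x. f x - lsq_estimator \<alpha> \<beta> n N X (\<lambda>i. f (X i) + \<epsilon> i) x)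
      \<le> sqrt (2 * beta_const \<alpha> \<beta>) * r + sqrt (2 * \<kappa>) * sqrt (beta_const \<alpha> \<beta>) * (r + e)"
proof -
  let ?B = "B_mat \<alpha> \<beta> n N X" and ?A = "A_mat \<alpha> \<beta> n N X"
  define b where "b = beta_const \<alpha> \<beta>"
  define lmin lmax where "lmin = Min (spectrum ?A)" and "lmax = Max (spectrum ?A)"
  have b: "b > 0" unfolding b_def using ab by (intro beta_const_pos) auto
  have r: "r \<ge> 0" using P(2)[of 0] by (auto intro: order_trans[OF abs_ge_zero])
  have e0: "e \<ge> 0" using e[of 1] n by (auto intro: order_trans[OF abs_ge_zero])
  have lmin: "lmin > 0"
    unfolding lmin_def by (rule gram_Min_spectrum_pos[OF B_mat_carrier A_mat_def inv]) simp
  have lmax: "1 / b \<le> lmax" unfolding b_def lmax_def by (rule Max_spectrum_A_mat_ge[OF ab n])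
  have "lmax > 0" using lmax b by (meson less_le_trans zero_less_divide_1_iff)
  with lmin show \<kappa>: "\<kappa> \<ge> 0" by (simp add: \<kappa>_def lmin_def lmax_def)
  obtain c where c: "\<And>x. poly P x = (\<Sum>k\<le>N. c k * njacobi \<alpha> \<beta> k x)"
    using njacobi_expansion[OF ab P(1)] by blast
  let ?c = "Matrix.vec (N + 1) c"
  let ?y = "(1 / sqrt (real n)) \<cdot>\<^sub>v Matrix.vec n (\<lambda>j. f (X (j + 1)) + \<epsilon> (j + 1))"
  let ?C = "lsq_coeffs \<alpha> \<beta> n N X (\<lambda>i. f (X i) + \<epsilon> i)"
  define d where "d = ?C - ?c"
  define w where "w = ?y - ?B *\<^sub>v ?c"
  have d_eq: "d = (the (mat_inverse ?A) * transpose_mat ?B) *\<^sub>v ?y - ?c"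
    by (simp add: d_def lsq_coeffs_def)
  have stable: "lmin * scalar_prod d d \<le> scalar_prod w w"
    unfolding lmin_def d_eq w_def
    by (rule least_squares_stable[OF B_mat_carrier A_mat_def inv]) auto
  have w: "scalar_prod w w \<le> (r + e)\<^sup>2"
  proof (rule scalar_prod_self_le)
    show "dim_vec w = n" by (simp add: w_def B_mat_def)
    fix j assume j: "j < n"
    have "vec_index w j = 1 / sqrt (real n) * ((f (X (j + 1)) - poly P (X (j + 1))) + \<epsilon> (j + 1))"
    proof -
      have "vec_index w j = vec_index ?y j - vec_index (?B *\<^sub>v ?c) j"
        unfolding w_def using j by (intro index_minus_vec) (simp add: B_mat_def)
      also have "\<dots> = 1 / sqrt (real n) * (f (X (j + 1)) + \<epsilon> (j + 1)) - 1 / sqrt (real n) * poly P (X (j + 1))"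
        unfolding B_mat_mult_vec[OF j] c using j by simp
      finally show ?thesis by (simp add: algebra_simps)
    qed
    then have "sqrt (real n) * vec_index w j = (f (X (j + 1)) - poly P (X (j + 1))) + \<epsilon> (j + 1)"
      using n by simp
    moreover have "\<bar>f (X (j + 1)) - poly P (X (j + 1))\<bar> \<le> r" using j by (intro P(2) X) auto
    moreover have "\<bar>\<epsilon> (j + 1)\<bar> \<le> e" using j by (intro e) auto
    ultimately show "\<bar>sqrt (real n) * vec_index w j\<bar> \<le> r + e" by linarith
  qed (use r e0 in simp)
  have dimd: "dim_vec d = N + 1" by (simp add: d_def)
  have dd: "scalar_prod d d = (\<Sum>k\<le>N. (vec_index d k)\<^sup>2)"
    unfolding scalar_prod_def dimd by (simp add: power2_eq_square atLeast0AtMost[symmetric] atLeastLessThanSuc_atLeastAtMost del: sum.op_ivl_Suc)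
  have "scalar_prod d d \<le> (r + e)\<^sup>2 / lmin"
    using stable w lmin by (simp add: field_simps)
  \<comment> \<open>The factor b lmax \<ge> 1 is inserted to turn 1 / lmin into the condition
    number.\<close>
  also have "\<dots> \<le> (b * lmax) * (r + e)\<^sup>2 / lmin"
  proof -
    have "1 \<le> b * lmax" using lmax b by (simp add: field_simps)
    then have "1 * (r + e)\<^sup>2 \<le> (b * lmax) * (r + e)\<^sup>2" by (intro mult_right_mono) auto
    then show ?thesis using lmin by (simp add: divide_right_mono)
  qed
  also have "\<dots> = \<kappa> * b * (r + e)\<^sup>2" by (simp add: \<kappa>_def lmin_def lmax_def)
  finally have d: "scalar_prod d d \<le> \<kappa> * b * (r + e)\<^sup>2" .
  have "wnorm \<alpha> \<beta> (\<lambda>x. f x - lsq_estimator \<alpha> \<beta> n N X (\<lambda>i. f (X i) + \<epsilon> i) x)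
    \<le> sqrt (2 * b * r\<^sup>2 + 2 * (\<Sum>k\<le>N. (vec_index d k)\<^sup>2))"
    unfolding b_def
  proof (rule wnorm_le_njacobi_sum[OF ab])
    fix x assume x: "x \<in> I"
    have "(\<Sum>k\<le>N. vec_index d k * njacobi \<alpha> \<beta> k x) =
      (\<Sum>k\<le>N. vec_index ?C k * njacobi \<alpha> \<beta> k x - c k * njacobi \<alpha> \<beta> k x)"
      by (intro sum.cong refl) (simp add: d_def left_diff_distrib)
    also have "\<dots> = lsq_estimator \<alpha> \<beta> n N X (\<lambda>i. f (X i) + \<epsilon> i) x - poly P x"
      by (simp add: lsq_estimator_eq c sum_subtractf)
    finally show "\<bar>f x - lsq_estimator \<alpha> \<beta> n N X (\<lambda>i. f (X i) + \<epsilon> i) x + (\<Sum>k\<le>N. vec_index d k * njacobi \<alpha> \<beta> k x)\<bar> \<le> r"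
      using P(2)[OF x] by simp
  qed
  also have "\<dots> \<le> sqrt (2 * b * r\<^sup>2 + 2 * (\<kappa> * b * (r + e)\<^sup>2))"
    using d unfolding dd by simp
  also have "\<dots> \<le> sqrt (2 * b * r\<^sup>2) + sqrt (2 * (\<kappa> * b * (r + e)\<^sup>2))"
    using b \<kappa> by (intro sqrt_add_le_add_sqrt) auto
  also have "sqrt (2 * (\<kappa> * b * (r + e)\<^sup>2)) = sqrt (2 * \<kappa> * b * (r + e)\<^sup>2)" by (simp add: mult.assoc)
  also have "sqrt (2 * b * r\<^sup>2) + sqrt (2 * \<kappa> * b * (r + e)\<^sup>2) =
      sqrt (2 * b) * r + sqrt (2 * \<kappa>) * sqrt b * (r + e)"
    using r e0 by (simp only: real_sqrt_mult real_sqrt_abs abs_of_nonneg add_nonneg_nonneg)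
  finally show "wnorm \<alpha> \<beta> (\<lambda>x. f x - lsq_estimator \<alpha> \<beta> n N X (\<lambda>i. f (X i) + \<epsilon> i) x)
      \<le> sqrt (2 * beta_const \<alpha> \<beta>) * r + sqrt (2 * \<kappa>) * sqrt (beta_const \<alpha> \<beta>) * (r + e)"
    by (simp add: b_def)
qed

section \<open>The almost sure event and the final constants\<close>

text \<open>The density vanishes off \<open>I\<close>, and finitely many almost sure events are
  intersected. A measurable set is extracted because the claim asks for an event.\<close>

lemma regression_sample_in_I:
  assumes "regression_sample \<alpha> \<beta> \<nu> n M X \<epsilon>"
  shows "\<exists>E\<in>sets M. measure M E = 1 \<and> (\<forall>s\<in>E. \<forall>i\<in>{1..n}. X i s \<in> I)"
proof -
  interpret prob_space M using assms by (simp add: regression_sample_def)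
  have "AE s in M. X i s \<in> I" if "i \<in> {1..n}" for i
  proof -
    have D: "distributed M lborel (X i) (beta_density \<alpha> \<beta>)"
      using assms that by (simp add: regression_sample_def)
    have "AE x in density lborel (beta_density \<alpha> \<beta>). x \<in> I"
      using distributed_borel_measurable[OF D]
      by (subst AE_density) (auto simp: beta_density_def indicator_def intro!: AE_I2)
    then have "AE x in distr M lborel (X i). x \<in> I"
      by (simp only: distributed_distr_eq_density[OF D])
    then show ?thesis
      using distributed_measurable[OF D] by (subst (asm) AE_distr_iff) auto
  qed
  then have "AE s in M. \<forall>i\<in>{1..n}. X i s \<in> I" by (intro AE_finite_allI) auto
  then obtain E where "E \<subseteq> {s \<in> space M. \<forall>i\<in>{1..n}. X i s \<in> I}" "E \<in> events" "prob E = 1"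
    by (rule AE_E_prob)
  then show ?thesis by blast
qed

text \<open>Applied with \<open>t = 1 / sqrt (beta_const \<alpha> \<beta>)\<close>: the denominator
  of the claim is positive for large n.\<close>

lemma eventually_denominator_pos:
  fixes t L s :: real
  assumes "t > 0" "L \<ge> 0"
  shows "\<exists>n0. \<forall>n\<ge>n0. 2 * (1 / real n * L) powr (1/4) * s < t"
proof -
  have "(\<lambda>n. 1 / real n * L) \<longlonglongrightarrow> 0 * L" by (intro tendsto_mult lim_1_over_n tendsto_const)
  then have "(\<lambda>n. (1 / real n * L) powr (1/4)) \<longlonglongrightarrow> (0 * L) powr (1/4)"
    using assms(2) by (intro tendsto_powr2[OF _ tendsto_const]) (auto intro!: always_eventually)
  from tendsto_mult[OF tendsto_mult[OF tendsto_const[of 2] this] tendsto_const[of s]]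
  have "(\<lambda>n. 2 * (1 / real n * L) powr (1/4) * s) \<longlonglongrightarrow> 0" by simp
  then have "\<forall>\<^sub>F n in sequentially. 2 * (1 / real n * L) powr (1/4) * s < t"
    using assms(1) by (rule order_tendstoD(2))
  then show ?thesis by (simp add: eventually_sequentially)
qed

text \<open>Here a and b are the two logarithmic rates, e the noise maximum and s = sqrt(2
  \<kappa>). The bound on \<open>den\<close> gives sqrt G \<le> 1 / den, which absorbs sqrt G; the
  factor (1 + C1) (1 + sqrt(2 G)) dominates the constants of both terms.\<close>

lemma risk_bound_arith:
  fixes G C1 r a b e s den :: real
  assumes "G > 0" "C1 \<ge> 0" "r \<le> C1 * a" "r \<le> C1 * b" "a \<ge> 0" "b \<ge> 0" "e \<ge> 0" "s \<ge> 0"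
    and den: "0 < den" "den \<le> 1 / sqrt G"
  shows "sqrt (2 * G) * r + s * sqrt G * (r + e) \<le> (1 + C1) * (1 + sqrt (2 * G)) * (a + s * ((b + e) / den))"
proof -
  define g where "g = sqrt (2 * G)"
  have g: "g \<ge> 0" using assms(1) by (simp add: g_def)
  have "sqrt G * (b + e) \<le> (b + e) / den"
  proof -
    have "sqrt G * den \<le> 1" using den assms(1) by (simp add: field_simps)
    then have "sqrt G * den * (b + e) \<le> 1 * (b + e)" using assms by (intro mult_right_mono) auto
    then show ?thesis using den by (simp add: field_simps)
  qed
  then have 1: "s * (sqrt G * (b + e)) \<le> s * ((b + e) / den)" using assms by (intro mult_left_mono)
  have "(1 + C1) * (b + e) = b + e + C1 * b + C1 * e" by (simp add: algebra_simps)
  moreover have "C1 * e \<ge> 0" using assms by simp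
  ultimately have "r + e \<le> (1 + C1) * (b + e)" using assms by linarith
  then have "s * sqrt G * (r + e) \<le> s * sqrt G * ((1 + C1) * (b + e))"
    using assms by (intro mult_left_mono) auto
  also have "\<dots> = (1 + C1) * (s * (sqrt G * (b + e)))" by (simp add: algebra_simps)
  also have "\<dots> \<le> (1 + C1) * (s * ((b + e) / den))" by (rule mult_left_mono[OF 1]) (use assms in simp)
  also have "\<dots> \<le> (1 + C1) * (1 + g) * (s * ((b + e) / den))"
  proof -
    have "(1 + C1) * 1 \<le> (1 + C1) * (1 + g)" using g assms by (intro mult_left_mono) auto
    then show ?thesis using assms den by (intro mult_right_mono) auto
  qed
  finally have 2: "s * sqrt G * (r + e) \<le> (1 + C1) * (1 + g) * (s * ((b + e) / den))" .
  have "g * r \<le> g * (C1 * a)" using g assms by (intro mult_left_mono)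
  also have "\<dots> = (g * C1) * a" by simp
  also have "\<dots> \<le> (1 + C1) * (1 + g) * a"
    using g assms by (intro mult_right_mono) (auto simp: algebra_simps)
  finally have "g * r \<le> (1 + C1) * (1 + g) * a" .
  from add_mono[OF this 2] show ?thesis unfolding g_def by (simp only: distrib_left[of _ a])
qed

theorem corollary1:
  fixes \<alpha> \<beta> \<mu> \<tau> \<gamma> \<sigma> \<delta> :: real and p :: nat
    and f :: "real \<Rightarrow> real" and D :: "nat \<Rightarrow> real \<Rightarrow> real"
    and \<nu> :: "real measure"
  assumes "\<alpha> \<ge> -1/2" and "\<beta> \<ge> -1/2"
    and "\<mu> = max \<alpha> \<beta>" and "\<tau> = min \<alpha> \<beta>"
    and "0 < \<gamma>" and "\<gamma> < 1"
    and "cont_derivs p f D" and "D p \<in> Lip \<gamma>"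
    and "wnorm \<alpha> \<beta> f > 0" and "supnorm f > 0"
    and "real p + \<gamma> \<ge> max (\<mu> + 1/2) (1/2 - \<tau>)"
    and "centered_law \<nu> \<sigma>"
    and "0 < \<delta>" and "\<delta> < 1"
  shows "\<exists>C>0. \<exists>n0 N0. \<forall>n\<ge>n0. \<forall>N\<ge>N0.
    n > N \<longrightarrow>
    0.63 * real n > m2_const \<alpha> \<beta> * real (N + 1) powr (2 * \<mu> + 2) * ln (real (N + 1)) \<longrightarrow>
    (\<forall>(M :: 'a measure) X \<epsilon>. regression_sample \<alpha> \<beta> \<nu> n M X \<epsilon> \<longrightarrow>
      (\<exists>E\<in>sets M. measure M E \<ge> (1 - \<delta>)\<^sup>2 \<and>
        (\<forall>s\<in>E.
          let fhat = lsq_estimator \<alpha> \<beta> n N (\<lambda>i. X i s) (\<lambda>i. f (X i s) + \<epsilon> i s);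
              A = A_mat \<alpha> \<beta> n N (\<lambda>i. X i s);
              eta = (MAX i\<in>{1..n}. \<bar>\<epsilon> i s\<bar>)
          in ereal (wnorm \<alpha> \<beta> (\<lambda>x. f x - fhat x))
             \<le> ereal C *
               (ereal (ln (real N) / real N powr (real p + \<gamma>)) +
                ereal_sqrt (2 * cond2 A) *
                ereal ((ln (real N) / real N powr (real p + \<gamma> - \<mu> - 1/2) + eta) /
                  (1 / sqrt (beta_const \<alpha> \<beta>) -
                   2 * (1 / real n * ln (2 / \<delta>)) powr (1/4) * (supnorm f / wnorm \<alpha> \<beta> f)))))))"
proof -
  define q where "q = real p + \<gamma>"
  define G where "G = beta_const \<alpha> \<beta>"
  define L where "L = ln (2 / \<delta>)"
  define S where "S = supnorm f / wnorm \<alpha> \<beta> f"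
  have G: "G > 0" unfolding G_def using assms(1,2) by (intro beta_const_pos) auto
  have L: "L \<ge> 0" unfolding L_def using assms by simp
  have S: "S \<ge> 0" unfolding S_def using assms by simp
  have \<mu>: "\<mu> + 1/2 \<ge> 0" using assms by simp
  obtain C1 where C1: "C1 \<ge> 0" and jackson: "\<And>N. N \<ge> p \<Longrightarrow> \<exists>P. Polynomial.degree P \<le> N \<and>
      (\<forall>x\<in>I. \<bar>f x - poly P x\<bar> \<le> C1 / real (N + 1) powr q)"
    using jackson_cont_derivs[OF assms(7,8,5)] assms(6) unfolding q_def by auto
  obtain n0 where n0: "\<And>n. n \<ge> n0 \<Longrightarrow> 2 * (1 / real n * L) powr (1/4) * S < 1 / sqrt G"
    using eventually_denominator_pos[of "1 / sqrt G" L S] G L by auto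
  \<comment> \<open>Only the weight and the Jackson constant of f enter; \<delta> affects
    \<open>n0\<close> alone.\<close>
  define C where "C = (1 + C1) * (1 + sqrt (2 * G))"
  have "C > 0" unfolding C_def using C1 G by (intro mult_pos_pos add_pos_nonneg) auto
  moreover have "\<exists>E\<in>sets M. measure M E \<ge> (1 - \<delta>)\<^sup>2 \<and>
        (\<forall>s\<in>E.
          let fhat = lsq_estimator \<alpha> \<beta> n N (\<lambda>i. X i s) (\<lambda>i. f (X i s) + \<epsilon> i s);
              A = A_mat \<alpha> \<beta> n N (\<lambda>i. X i s);
              eta = (MAX i\<in>{1..n}. \<bar>\<epsilon> i s\<bar>)
          in ereal (wnorm \<alpha> \<beta> (\<lambda>x. f x - fhat x))
             \<le> ereal C *
               (ereal (ln (real N) / real N powr (real p + \<gamma>)) +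
                ereal_sqrt (2 * cond2 A) *
                ereal ((ln (real N) / real N powr (real p + \<gamma> - \<mu> - 1/2) + eta) /
                  (1 / sqrt (beta_const \<alpha> \<beta>) -
                   2 * (1 / real n * ln (2 / \<delta>)) powr (1/4) * (supnorm f / wnorm \<alpha> \<beta> f)))))"
    \<comment> \<open>N is at least p for Jackson's theorem, and at least 3 > e so that ln N \<ge>
      1.\<close>
    if n: "n \<ge> n0" and N: "N \<ge> max p 3" and nN: "n > N" and sample: "regression_sample \<alpha> \<beta> \<nu> n M X \<epsilon>"
    for n N and M :: "'a measure" and X \<epsilon>
  proof -
    obtain E where E: "E \<in> sets M" "measure M E = 1" "\<And>s i. s \<in> E \<Longrightarrow> i \<in> {1..n} \<Longrightarrow> X i s \<in> I"
      using regression_sample_in_I[OF sample] by blast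
    have "(1 - \<delta>)\<^sup>2 \<le> 1" using assms by (simp add: abs_square_le_1)
    define a where "a = ln (real N) / real N powr q"
    define b where "b = ln (real N) / real N powr (q - \<mu> - 1/2)"
    define den where "den = 1 / sqrt G - 2 * (1 / real n * L) powr (1/4) * S"
    have den: "0 < den" "den \<le> 1 / sqrt G" using n0[OF n] S by (simp_all add: den_def)
    have lnN: "ln (real N) \<ge> 1"
    proof -
      have "exp 1 \<le> real N" using exp_le N by linarith
      then show ?thesis using N by (subst ln_ge_iff) auto
    qed
    define r where "r = C1 / real (N + 1) powr q"
    have q0: "q \<ge> 0" using assms(5) by (simp add: q_def)
    \<comment> \<open>Jackson's rate has no logarithm; ln N \<ge> 1 puts it below the rate of the
      claim.\<close>
    have r_le: "r \<le> C1 * a"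
    proof -
      have "real N powr q \<le> real (N + 1) powr q" using q0 by (intro powr_mono2) auto
      then have "1 / real (N + 1) powr q \<le> 1 / real N powr q" using N by (intro divide_left_mono) auto
      also have "\<dots> \<le> a" unfolding a_def using lnN by (intro divide_right_mono) auto
      finally have "C1 * (1 / real (N + 1) powr q) \<le> C1 * a" using C1 by (intro mult_left_mono)
      then show ?thesis by (simp add: r_def)
    qed
    have ab: "a \<le> b"
      unfolding a_def b_def using N \<mu> lnN by (intro divide_left_mono powr_mono) auto
    have a: "a > 0" unfolding a_def using lnN N by (intro divide_pos_pos) auto
    have r_le': "r \<le> C1 * b" using r_le mult_left_mono[OF ab C1] by linarith
    obtain P where P: "Polynomial.degree P \<le> N" "\<And>x. x \<in> I \<Longrightarrow> \<bar>f x - poly P x\<bar> \<le> r"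
      using jackson[of N] N unfolding r_def by auto
    have main: "ereal (wnorm \<alpha> \<beta> (\<lambda>x. f x - lsq_estimator \<alpha> \<beta> n N (\<lambda>i. X i s) (\<lambda>i. f (X i s) + \<epsilon> i s) x))
      \<le> ereal C * (ereal a + ereal_sqrt (2 * cond2 (A_mat \<alpha> \<beta> n N (\<lambda>i. X i s))) * ereal ((b + eta) / den))"
      if s: "s \<in> E" and eta_def: "eta = (MAX i\<in>{1..n}. \<bar>\<epsilon> i s\<bar>)" for s eta
    proof -
      let ?A = "A_mat \<alpha> \<beta> n N (\<lambda>i. X i s)"
      have e: "\<bar>\<epsilon> i s\<bar> \<le> eta" if "i \<in> {1..n}" for i
        unfolding eta_def using that by (intro Max_ge) auto
      have eta: "eta \<ge> 0" using e[of 1] nN by (auto intro: order_trans[OF abs_ge_zero])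
      show ?thesis
      proof (cases "invertible_mat ?A")
        case False
        define z where "z = (b + eta) / den"
        \<comment> \<open>Strict positivity matters: in \<open>ereal\<close> the product of infinity
          and 0 is 0, so the right-hand side is infinite only because z is not 0.\<close>
        have "z > 0" unfolding z_def using a ab eta den by (intro divide_pos_pos) auto
        then show ?thesis using False \<open>C > 0\<close>
          unfolding z_def[symmetric] by (simp add: cond2_def ereal_sqrt_def)
      next
        case True
        define \<kappa> where "\<kappa> = Max (spectrum ?A) / Min (spectrum ?A)"
        have "n > 0" using nN by simp
        note err = lsq_estimator_error[OF assms(1,2) this E(3)[OF s] P e True, folded \<kappa>_def G_def]
        have "wnorm \<alpha> \<beta> (\<lambda>x. f x - lsq_estimator \<alpha> \<beta> n N (\<lambda>i. X i s) (\<lambda>i. f (X i s) + \<epsilon> i s) x)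
          \<le> sqrt (2 * G) * r + sqrt (2 * \<kappa>) * sqrt G * (r + eta)"
          by (rule err(2))
        also have "\<dots> \<le> C * (a + sqrt (2 * \<kappa>) * ((b + eta) / den))"
          unfolding C_def using err(1) a ab eta
          by (intro risk_bound_arith G C1 r_le r_le' den) auto
        finally have "wnorm \<alpha> \<beta> (\<lambda>x. f x - lsq_estimator \<alpha> \<beta> n N (\<lambda>i. X i s) (\<lambda>i. f (X i s) + \<epsilon> i s) x)
          \<le> C * (a + sqrt (2 * \<kappa>) * ((b + eta) / den))" .
        moreover have "ereal_sqrt (2 * cond2 ?A) = ereal (sqrt (2 * \<kappa>))"
          using True by (simp add: cond2_def ereal_sqrt_def \<kappa>_def)
        ultimately show ?thesis by simp
      qed
    qed
    show ?thesis
    proof (intro bexI[of _ E] conjI ballI)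
      show "(1 - \<delta>)\<^sup>2 \<le> measure M E" using \<open>(1 - \<delta>)\<^sup>2 \<le> 1\<close> E(2) by simp
    qed (use main E(1) in \<open>simp_all only: Let_def a_def b_def den_def q_def G_def L_def S_def\<close>)
  qed
  ultimately show ?thesis by (intro exI[of _ C] conjI exI[of _ n0] exI[of _ "max p 3"]) blast+
qed


end
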